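(* Let $f,g:\mathbb{R}^d\to\mathbb{R}^d$ satisfy the linear growth, one-sided dissipative Lipschitz and integrability conditions recalled in the context, let $a_1,a_2\in\mathbb{R}\setminus\{0\}$ and $b_1,b_2\in\mathbb{R}^d$. For $\kappa\ge1$ let $(\bar U_\kappa(t,\omega),\bar V_\kappa(t,\omega))$ be the stationary solution, given by the singleton random attractor, of the coupled random differential equations $$\frac{dU}{dt}=e^{-a_1O^1_t}f\Big(Ue^{a_1O^1_t}+\frac{b_1}{a_1}(e^{a_1O^1_t}-1)\Big)+(a_1U+b_1)O^1_t+\kappa(V-U),$$ $$\frac{dV}{dt}=e^{-a_2O^2_t}g\Big(Ve^{a_2O^2_t}+\frac{b_2}{a_2}(e^{a_2O^2_t}-1)\Big)+(a_2V+b_2)O^2_t+\kappa(U-V),$$ and let $\bar W(t,\omega)$ be the unique stationary solution of the averaged equation $$\frac{dW}{dt}=\frac12\Big[e^{-a_1O^1_t}f\Big(e^{a_1O^1_t}W+\frac{b_1}{a_1}(e^{a_1O^1_t}-1)\Big)+e^{-a_2O^2_t}g\Big(e^{a_2O^2_t}W+\frac{b_2}{a_2}(e^{a_2O^2_t}-1)\Big)\Big]+\frac12\big[(a_1W+b_1)O^1_t+(a_2W+b_2)O^2_t\big].$$ Then for any sequence $\kappa_n\to\infty$ in $\mathbb{R}$, $$\big(\bar U_{\kappa_n}(t,\omega),\bar V_{\kappa_n}(t,\omega)\big)\to\big(\bar W(t,\omega),\bar W(t,\omega)\big)$$ pathwise, uniformly on bounded time intervals $[T_1,T_2]\subset\m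athbb{R}$.
   Context: Norm and inner product are Euclidean on $\mathbb{R}^d$. Conditions on $f,g$: for each $h\in\{f,g\}$: (linear growth) $\|h(x)\|\le l\|x\|+M$ for all $x$, with constants $l,M>0$; (one-sided dissipative Lipschitz) $\langle x-y,h(x)-h(y)\rangle\le -L\|x-y\|^2$ for all $x,y$, with a constant $L>0$; (integrability) there is $m_0>0$ such that $\int_{-\infty}^0 e^{ms}(\|f(u(s))\|^2+\|g(u(s))\|^2)ds<\infty$ for every $m\in(0,m_0]$ and every continuous $u:\mathbb{R}\to\mathbb{R}^d$ of sub-exponential growth (for every $\epsilon>0$ there are $C>0$, $t_0$ with $\|u(t)\|\le Ce^{\epsilon|t|}$ for $|t|\ge t_0$). Noise: $B^{H_1},B^{H_2}$ are independent two-sided one-dimensional fractional Brownian motions with Hurst parameters $H_1,H_2\in(\frac12,1)$ (continuous centered Gaussian, covariance $\frac12(|t|^{2H}+|s|^{2H}-|t-s|^{2H})$ with $H=H_1$, $H_2$ respectively), realized canonically on path space $C_0(\mathbb{R},\mathbb{R}^2)$ (continuous paths vanishing at $0$) with the law $\mathbb{P}$ of $(B^{H_1},B^{H_2})$ and the shift $\theta_t\omega(\cdot)=\omega(\cdot+t)-\omega(t)$. $O^i_t=e^{-t}\int_{-\infty}^te^s\,dB^{H_i}_s$ is the stationary fractional Ornstein–Uhlenbeck process, solving $dO^i_t=-O^i_t\,dt+dB^{H_i}_t$, $i=1,2$. The sample space $\Omega$ is restricted once and for all to a $\theta$-invariant set of full measure of paths on which the almost sure path properties used (local Hölder continuity,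 growth bounds, ergodic averages) hold; "pathwise" means for every $\omega$ in this set. A stationary solution is a solution of the form $t\mapsto x(\theta_t\omega)$ for a random variable $x$. For $\kappa\ge1$, $\bar U_\kappa(t,\omega)=\bar U_\kappa(\theta_t\omega)$ and $\bar V_\kappa(t,\omega)=\bar V_\kappa(\theta_t\omega)$, where $\mathcal{A}_\kappa(\omega)=\{(\bar U_\kappa(\omega),\bar V_\kappa(\omega))\}$ is the random attractor of the random dynamical system $\phi$ on $\mathbb{R}^{2d}$ generated by the coupled equations ($\phi(t,\omega,\cdot)$ maps the initial value at time $0$ to the value of the solution at time $t$). Random attractor: a compact tempered random set $\mathcal{A}$ with $\phi(t,\omega,\mathcal{A}(\omega))=\mathcal{A}(\theta_t\omega)$ for $t>0$ and $\lim_{t\to\infty}\sup_{x\in\phi(t,\theta_{-t}\omega,D(\theta_{-t}\omega))}\inf_{y\in\mathcal{A}(\omega)}\|x-y\|=0$ for every tempered closed random set $D$; a random set $D$ is tempered if $\log^+\big(\sup_{x\in D(\theta_t\omega)}\|x\|\big)/|t|\to0$ as $t\to\pm\infty$.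
   Formalization: Stationary solutions of the averaged equation are unique only up to null sets, so convergence is stated for almost every ω for any stationary solution W̄, and for every ω in the restricted sample space when W̄ is tempered. *)

theory Defs
  imports "HOL-Probability.Probability"
begin

section \<open>Fractional Brownian noise on path space\<close>

type_synonym path = "real \<Rightarrow> real \<times> real"

text \<open>\<open>C\<^sub>0(\<real>, \<real>\<^sup>2)\<close> with the \<open>\<sigma>\<close>-algebra of the coordinate evaluations, which is the Borel
  \<open>\<sigma>\<close>-algebra of locally uniform convergence. Only the measurable structure of this
  measure space is used; its measure is irrelevant.\<close>

definition path_space :: "path measure" where
  "path_space = restrict_space (Pi\<^sub>M UNIV (\<lambda>_. borel)) {\<omega>. continuous_on UNIV \<omega> \<and> \<omega> 0 = 0}"

definition path_shift :: "real \<Rightarrow> path \<Rightarrow> path" where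
  "path_shift t \<omega> = (\<lambda>s. \<omega> (s + t) - \<omega> t)"

text \<open>Degenerate (almost surely constant) variables count as Gaussian.\<close>

definition gaussian_rv :: "'s measure \<Rightarrow> ('s \<Rightarrow> real) \<Rightarrow> bool" where
  "gaussian_rv M X \<longleftrightarrow> X \<in> borel_measurable M \<and>
     (\<exists>\<mu>. (AE x in M. X x = \<mu>) \<or> (\<exists>\<sigma>>0. distributed M lborel X (normal_density \<mu> \<sigma>)))"

definition gaussian_process :: "'s measure \<Rightarrow> (real \<Rightarrow> 's \<Rightarrow> real) \<Rightarrow> bool" where
  "gaussian_process M X \<longleftrightarrow>
     (\<forall>T c. finite T \<longrightarrow> gaussian_rv M (\<lambda>\<omega>. \<Sum>t\<in>T. c t * X t \<omega>))"

definition fractional_brownian_motion :: "'s measure \<Rightarrow> real \<Rightarrow> (real \<Rightarrow> 's \<Rightarrow> real) \<Rightarrow> bool" where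
  "fractional_brownian_motion M H B \<longleftrightarrow>
     prob_space M \<and> gaussian_process M B \<and>
     (\<forall>\<omega>\<in>space M. continuous_on UNIV (\<lambda>t. B t \<omega>)) \<and>
     (\<forall>t. (\<integral>\<omega>. B t \<omega> \<partial>M) = 0) \<and>
     (\<forall>s t. (\<integral>\<omega>. B t \<omega> * B s \<omega> \<partial>M) =
        (\<bar>t\<bar> powr (2 * H) + \<bar>s\<bar> powr (2 * H) - \<bar>t - s\<bar> powr (2 * H)) / 2)"

definition fbm_path_law :: "real \<Rightarrow> real \<Rightarrow> path measure \<Rightarrow> bool" where
  "fbm_path_law H\<^sub>1 H\<^sub>2 P \<longleftrightarrow>
     prob_space P \<and> sets P = sets path_space \<and>
     fractional_brownian_motion P H\<^sub>1 (\<lambda>t \<omega>. fst (\<omega> t)) \<and>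
     fractional_brownian_motion P H\<^sub>2 (\<lambda>t \<omega>. snd (\<omega> t)) \<and>
     prob_space.indep_var P
       (Pi\<^sub>M UNIV (\<lambda>_. borel)) (\<lambda>\<omega> t. fst (\<omega> t))
       (Pi\<^sub>M UNIV (\<lambda>_. borel)) (\<lambda>\<omega> t. snd (\<omega> t))"


section \<open>The fractional Ornstein--Uhlenbeck process\<close>

text \<open>Riemann--Stieltjes integral (limit of sums as the mesh tends to zero). For the integrand
  \<open>exp\<close> and a continuous integrator it exists, so the stochastic integral defining the
  Ornstein--Uhlenbeck process is a pathwise one.\<close>

definition has_RS_integral ::
  "(real \<Rightarrow> real) \<Rightarrow> (real \<Rightarrow> real) \<Rightarrow> real \<Rightarrow> real \<Rightarrow> real \<Rightarrow> bool" where
  "has_RS_integral h x a b I \<longleftrightarrow>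
     (\<forall>e>0. \<exists>\<delta>>0. \<forall>D. D tagged_division_of {a..b} \<and> (\<forall>(s, K)\<in>D. diameter K < \<delta>) \<longrightarrow>
        \<bar>(\<Sum>(s, K)\<in>D. h s * (x (Sup K) - x (Inf K))) - I\<bar> < e)"

definition RS_integral ::
  "(real \<Rightarrow> real) \<Rightarrow> (real \<Rightarrow> real) \<Rightarrow> real \<Rightarrow> real \<Rightarrow> real" where
  "RS_integral h x a b = (THE I. has_RS_integral h x a b I)"

definition fOU :: "(real \<Rightarrow> real) \<Rightarrow> real \<Rightarrow> real" where
  "fOU x t = exp (- t) * Lim at_bot (\<lambda>a. RS_integral exp x a t)"

abbreviation OU1 :: "path \<Rightarrow> real \<Rightarrow> real" where
  "OU1 \<omega> \<equiv> fOU (\<lambda>s. fst (\<omega> s))"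

abbreviation OU2 :: "path \<Rightarrow> real \<Rightarrow> real" where
  "OU2 \<omega> \<equiv> fOU (\<lambda>s. snd (\<omega> s))"

text \<open>The almost sure properties of a path \<open>x\<close> of fractional Brownian motion with Hurst
  parameter \<open>H\<close>: local Hoelder continuity of every order below \<open>H\<close>, sublinear growth of the
  path and of its Ornstein--Uhlenbeck path, and convergence of the first and second ergodic
  averages in both time directions. The parameter \<open>v\<close> is the stationary variance.\<close>

definition regular_path :: "real \<Rightarrow> real \<Rightarrow> (real \<Rightarrow> real) \<Rightarrow> bool" where
  "regular_path H v x \<longleftrightarrow>
     (\<forall>\<gamma> T. 0 < \<gamma> \<and> \<gamma> < H \<longrightarrow>
        (\<exists>C. \<forall>s\<in>{-T..T}. \<forall>t\<in>{-T..T}. \<bar>x t - x s\<bar> \<le> C * \<bar>t - s\<bar> powr \<gamma>)) \<and>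
     ((\<lambda>t. x t / t) \<longlongrightarrow> 0) at_infinity \<and>
     ((\<lambda>t. fOU x t / t) \<longlongrightarrow> 0) at_infinity \<and>
     ((\<lambda>T. integral {0..T} (fOU x) / T) \<longlongrightarrow> 0) at_top \<and>
     ((\<lambda>T. integral {-T..0} (fOU x) / T) \<longlongrightarrow> 0) at_top \<and>
     ((\<lambda>T. integral {0..T} (\<lambda>s. (fOU x s)\<^sup>2) / T) \<longlongrightarrow> v) at_top \<and>
     ((\<lambda>T. integral {-T..0} (\<lambda>s. (fOU x s)\<^sup>2) / T) \<longlongrightarrow> v) at_top"

text \<open>The restricted sample space may be any shift-invariant event of full measure consisting
  of regular paths.\<close>

definition restricted_sample_space ::
  "real \<Rightarrow> real \<Rightarrow> path measure \<Rightarrow> path set \<Rightarrow> bool" where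
  "restricted_sample_space H\<^sub>1 H\<^sub>2 P \<Omega> \<longleftrightarrow>
     \<Omega> \<in> sets P \<and> emeasure P \<Omega> = 1 \<and>
     (\<forall>t. path_shift t ` \<Omega> = \<Omega>) \<and>
     (\<forall>\<omega>\<in>\<Omega>. regular_path H\<^sub>1 (\<integral>\<omega>. (OU1 \<omega> 0)\<^sup>2 \<partial>P) (\<lambda>s. fst (\<omega> s)) \<and>
             regular_path H\<^sub>2 (\<integral>\<omega>. (OU2 \<omega> 0)\<^sup>2 \<partial>P) (\<lambda>s. snd (\<omega> s)))"


section \<open>Random dynamical systems and random attractors\<close>

definition metric_dynamical_system :: "'s measure \<Rightarrow> (real \<Rightarrow> 's \<Rightarrow> 's) \<Rightarrow> bool" where
  "metric_dynamical_system M \<theta> \<longleftrightarrow>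
     prob_space M \<and>
     (\<lambda>(t, \<omega>). \<theta> t \<omega>) \<in> borel \<Otimes>\<^sub>M M \<rightarrow>\<^sub>M M \<and>
     (\<forall>\<omega>\<in>space M. \<theta> 0 \<omega> = \<omega>) \<and>
     (\<forall>s t. \<forall>\<omega>\<in>space M. \<theta> (s + t) \<omega> = \<theta> s (\<theta> t \<omega>)) \<and>
     (\<forall>t. distr M M (\<theta> t) = M)"

definition random_dynamical_system ::
  "'s measure \<Rightarrow> (real \<Rightarrow> 's \<Rightarrow> 's) \<Rightarrow> (real \<Rightarrow> 's \<Rightarrow> 'x::euclidean_space \<Rightarrow> 'x) \<Rightarrow> bool" where
  "random_dynamical_system M \<theta> \<phi> \<longleftrightarrow>
     metric_dynamical_system M \<theta> \<and>
     (\<lambda>(t, \<omega>, x). \<phi> t \<omega> x) \<in> restrict_space borel {0..} \<Otimes>\<^sub>M M \<Otimes>\<^sub>M borel \<rightarrow>\<^sub>M borel \<and>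
     (\<forall>\<omega>\<in>space M. \<forall>x. \<phi> 0 \<omega> x = x) \<and>
     (\<forall>s\<ge>0. \<forall>t\<ge>0. \<forall>\<omega>\<in>space M. \<forall>x. \<phi> (s + t) \<omega> x = \<phi> s (\<theta> t \<omega>) (\<phi> t \<omega> x)) \<and>
     (\<forall>t\<ge>0. \<forall>\<omega>\<in>space M. continuous_on UNIV (\<phi> t \<omega>))"

text \<open>\<open>F t \<omega>\<close> is the right-hand side of the random differential equation at time \<open>t\<close>.\<close>

definition generated_by ::
  "'s measure \<Rightarrow> (real \<Rightarrow> 's \<Rightarrow> 'x::euclidean_space \<Rightarrow> 'x) \<Rightarrow>
   (real \<Rightarrow> 's \<Rightarrow> 'x \<Rightarrow> 'x) \<Rightarrow> bool" where
  "generated_by M \<phi> F \<longleftrightarrow>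
     (\<forall>\<omega>\<in>space M. \<forall>x. \<phi> 0 \<omega> x = x \<and>
        (\<forall>t\<ge>0. ((\<lambda>t. \<phi> t \<omega> x) has_vector_derivative F t \<omega> (\<phi> t \<omega> x)) (at t within {0..})))"

definition closed_random_set :: "'s measure \<Rightarrow> ('s \<Rightarrow> 'x::euclidean_space set) \<Rightarrow> bool" where
  "closed_random_set M D \<longleftrightarrow>
     (\<forall>\<omega>\<in>space M. closed (D \<omega>) \<and> D \<omega> \<noteq> {}) \<and>
     (\<forall>x. (\<lambda>\<omega>. infdist x (D \<omega>)) \<in> borel_measurable M)"

text \<open>Boundedness makes the supremum a real number; \<open>ln (max 1 r)\<close> is \<open>log\<^sup>+ r\<close>.\<close>

definition tempered ::
  "'s measure \<Rightarrow> (real \<Rightarrow> 's \<Rightarrow> 's) \<Rightarrow> ('s \<Rightarrow> 'x::euclidean_space set) \<Rightarrow> bool" where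
  "tempered M \<theta> D \<longleftrightarrow>
     (\<forall>\<omega>\<in>space M. bounded (D \<omega>) \<and>
        ((\<lambda>t. ln (max 1 (SUP x\<in>D (\<theta> t \<omega>). norm x)) / \<bar>t\<bar>) \<longlongrightarrow> 0) at_infinity)"

definition random_attractor ::
  "'s measure \<Rightarrow> (real \<Rightarrow> 's \<Rightarrow> 's) \<Rightarrow> (real \<Rightarrow> 's \<Rightarrow> 'x::euclidean_space \<Rightarrow> 'x) \<Rightarrow>
   ('s \<Rightarrow> 'x set) \<Rightarrow> bool" where
  "random_attractor M \<theta> \<phi> A \<longleftrightarrow>
     closed_random_set M A \<and> (\<forall>\<omega>\<in>space M. compact (A \<omega>)) \<and> tempered M \<theta> A \<and>
     (\<forall>\<omega>\<in>space M. \<forall>t>0. \<phi> t \<omega> ` A \<omega> = A (\<theta> t \<omega>)) \<and>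
     (\<forall>D. closed_random_set M D \<and> tempered M \<theta> D \<longrightarrow>
        (\<forall>\<omega>\<in>space M.
           ((\<lambda>t. SUP x\<in>\<phi> t (\<theta> (- t) \<omega>) ` D (\<theta> (- t) \<omega>). infdist x (A \<omega>)) \<longlongrightarrow> 0) at_top))"

text \<open>A stationary solution in this sense is determined only up to a null set: it can be altered
  along the orbit of a single \<open>\<omega>\<close> by following another solution, which however is not tempered
  there. Pointwise uniqueness, and hence a statement about every single \<open>\<omega>\<close>, requires the
  tempered version of it.\<close>

definition stationary_solution ::
  "'s measure \<Rightarrow> (real \<Rightarrow> 's \<Rightarrow> 's) \<Rightarrow> (real \<Rightarrow> 's \<Rightarrow> 'x::euclidean_space \<Rightarrow> 'x) \<Rightarrow>
   ('s \<Rightarrow> 'x) \<Rightarrow> bool" where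
  "stationary_solution M \<theta> F X \<longleftrightarrow>
     X \<in> borel_measurable M \<and>
     (\<forall>\<omega>\<in>space M. \<forall>t.
        ((\<lambda>t. X (\<theta> t \<omega>)) has_vector_derivative F t \<omega> (X (\<theta> t \<omega>))) (at t))"


section \<open>The coefficients and the equations\<close>

definition linear_growth :: "('x::euclidean_space \<Rightarrow> 'x) \<Rightarrow> bool" where
  "linear_growth h \<longleftrightarrow> (\<exists>l>0. \<exists>M>0. \<forall>x. norm (h x) \<le> l * norm x + M)"

definition dissipative_lipschitz :: "('x::euclidean_space \<Rightarrow> 'x) \<Rightarrow> bool" where
  "dissipative_lipschitz h \<longleftrightarrow>
     (\<exists>L>0. \<forall>x y. (x - y) \<bullet> (h x - h y) \<le> - L * (norm (x - y))\<^sup>2)"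

definition subexponential :: "(real \<Rightarrow> 'x::euclidean_space) \<Rightarrow> bool" where
  "subexponential u \<longleftrightarrow>
     (\<forall>\<epsilon>>0. \<exists>C>0. \<exists>t\<^sub>0. \<forall>t. \<bar>t\<bar> \<ge> t\<^sub>0 \<longrightarrow> norm (u t) \<le> C * exp (\<epsilon> * \<bar>t\<bar>))"

definition integrability_condition ::
  "('x::euclidean_space \<Rightarrow> 'x) \<Rightarrow> ('x \<Rightarrow> 'x) \<Rightarrow> bool" where
  "integrability_condition f g \<longleftrightarrow>
     (\<exists>m\<^sub>0>0. \<forall>m u. 0 < m \<and> m \<le> m\<^sub>0 \<and> continuous_on UNIV u \<and> subexponential u \<longrightarrow>
        set_integrable lborel {..0}
          (\<lambda>s. exp (m * s) * ((norm (f (u s)))\<^sup>2 + (norm (g (u s)))\<^sup>2)))"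

text \<open>\<open>e\<^bsup>-az\<^esup> h(e\<^bsup>az\<^esup> u + (b/a)(e\<^bsup>az\<^esup> - 1))\<close>\<close>

definition transformed_drift ::
  "('x::euclidean_space \<Rightarrow> 'x) \<Rightarrow> real \<Rightarrow> 'x \<Rightarrow> real \<Rightarrow> 'x \<Rightarrow> 'x" where
  "transformed_drift h a b z u =
     exp (- a * z) *\<^sub>R h (exp (a * z) *\<^sub>R u + ((exp (a * z) - 1) / a) *\<^sub>R b)"

definition coupled_field ::
  "('x::euclidean_space \<Rightarrow> 'x) \<Rightarrow> ('x \<Rightarrow> 'x) \<Rightarrow> real \<Rightarrow> real \<Rightarrow> 'x \<Rightarrow> 'x \<Rightarrow> real \<Rightarrow>
   real \<Rightarrow> path \<Rightarrow> 'x \<times> 'x \<Rightarrow> 'x \<times> 'x" where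
  "coupled_field f g a\<^sub>1 a\<^sub>2 b\<^sub>1 b\<^sub>2 \<kappa> t \<omega> = (\<lambda>(u, v).
     (transformed_drift f a\<^sub>1 b\<^sub>1 (OU1 \<omega> t) u + OU1 \<omega> t *\<^sub>R (a\<^sub>1 *\<^sub>R u + b\<^sub>1) + \<kappa> *\<^sub>R (v - u),
      transformed_drift g a\<^sub>2 b\<^sub>2 (OU2 \<omega> t) v + OU2 \<omega> t *\<^sub>R (a\<^sub>2 *\<^sub>R v + b\<^sub>2) + \<kappa> *\<^sub>R (u - v)))"

definition averaged_field ::
  "('x::euclidean_space \<Rightarrow> 'x) \<Rightarrow> ('x \<Rightarrow> 'x) \<Rightarrow> real \<Rightarrow> real \<Rightarrow> 'x \<Rightarrow> 'x \<Rightarrow>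
   real \<Rightarrow> path \<Rightarrow> 'x \<Rightarrow> 'x" where
  "averaged_field f g a\<^sub>1 a\<^sub>2 b\<^sub>1 b\<^sub>2 t \<omega> w =
     (1 / 2) *\<^sub>R (transformed_drift f a\<^sub>1 b\<^sub>1 (OU1 \<omega> t) w + transformed_drift g a\<^sub>2 b\<^sub>2 (OU2 \<omega> t) w) +
     (1 / 2) *\<^sub>R (OU1 \<omega> t *\<^sub>R (a\<^sub>1 *\<^sub>R w + b\<^sub>1) + OU2 \<omega> t *\<^sub>R (a\<^sub>2 *\<^sub>R w + b\<^sub>2))"

text \<open>Convergence along one path, for every sequence of coupling strengths tending to infinity,
  uniformly on every bounded time interval.\<close>

definition synchronizes ::
  "(real \<Rightarrow> 's \<Rightarrow> 's) \<Rightarrow> (real \<Rightarrow> 's \<Rightarrow> 'x::euclidean_space) \<Rightarrow> (real \<Rightarrow> 's \<Rightarrow> 'x) \<Rightarrow>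
   ('s \<Rightarrow> 'x) \<Rightarrow> 's \<Rightarrow> bool" where
  "synchronizes \<theta> U V W \<omega> \<longleftrightarrow>
     (\<forall>\<kappa> :: nat \<Rightarrow> real. filterlim \<kappa> at_top sequentially \<longrightarrow>
        (\<forall>T\<^sub>1 T\<^sub>2. uniform_limit {T\<^sub>1..T\<^sub>2}
           (\<lambda>n t. (U (\<kappa> n) (\<theta> t \<omega>), V (\<kappa> n) (\<theta> t \<omega>)))
           (\<lambda>t. (W (\<theta> t \<omega>), W (\<theta> t \<omega>))) sequentially))"

end

theory Submission
  imports Defs
begin

text \<open>
  Fix a noise path and write \<open>z\<^sub>1, z\<^sub>2\<close> for its two Ornstein--Uhlenbeck paths,
  \<open>\<alpha> = a\<^sub>1 z\<^sub>1\<close>, \<open>\<beta> = a\<^sub>2 z\<^sub>2\<close>, and \<open>F\<^sub>1, F\<^sub>2\<close> for the two uncoupled fields. Conjugating a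
  dissipative map by the affine change of variables keeps its dissipation rate, and the linear
  noise term shifts it, so \<open>F\<^sub>1\<close> and \<open>F\<^sub>2\<close> are one-sided Lipschitz with the rates \<open>- L + \<alpha>\<close> and \<open>- L + \<beta>\<close>
  (\<open>noisy_drift_dissipative\<close>). The averaged solution \<open>W\<close> satisfies \<open>W' = (F\<^sub>1(W) + F\<^sub>2(W)) / 2\<close>,
  hence \<open>(W, W)\<close> solves the coupled system up to a residual of the form \<open>(h, - h)\<close>, where
  \<open>h = (F\<^sub>2(W) - F\<^sub>1(W)) / 2\<close>. An antisymmetric residual acts on the error only through
  \<open>V - U\<close>, which is exactly what the coupling damps. Completing squares against
  \<open>- 2 \<kappa> |U - V|\<^sup>2\<close> gives (\<open>coupling_dissipation\<close>) for \<open>\<eta> = |U - W|\<^sup>2 + |V - W|\<^sup>2\<close>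
  the inequality
  \<open>\<eta>' \<le> (- 2 L + \<alpha> + \<beta> + (\<alpha>\<^sup>2 + \<beta>\<^sup>2) / \<kappa>) \<eta> + |h|\<^sup>2 / \<kappa>\<close>.

  In the past, \<open>\<alpha>\<close> and \<open>\<beta>\<close> have time average zero and \<open>\<alpha>\<^sup>2\<close>, \<open>\<beta>\<^sup>2\<close> have finite time
  averages. For large \<open>\<kappa>\<close> the coefficient of \<open>\<eta>\<close> therefore has a negative average, and
  contributions from time \<open>s\<close> decay exponentially as \<open>s \<rightarrow> - \<infinity>\<close>. As \<open>\<eta>\<close> and \<open>h\<close> grow
  subexponentially in the past, the value at \<open>- \<infinity>\<close> is forgotten and the forcing alone decides
  (\<open>pullback_comparison\<close>): \<open>\<eta> \<le> C / \<kappa>\<close> uniformly on bounded intervals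
  (\<open>synchronization_rate\<close>). No bound on \<open>(U, V)\<close> that is uniform in \<open>\<kappa>\<close> enters.

  Three facts connect this with the probabilistic setting. Integration by parts turns the
  Riemann--Stieltjes definition of the Ornstein--Uhlenbeck path into
  \<open>x(t) - e\<^bsup>-t\<^esup> \<integral>\<^bsub>-\<infinity>\<^esub>\<^bsup>t\<^esup> e\<^sup>s x(s) ds\<close> (\<open>fOU_eq\<close>), so it is continuous and commutes with the shift.
  Invariance of the attractor, applied from arbitrarily early starting points, makes it a solution
  on all of \<open>\<real>\<close> (\<open>invariant_point_solves\<close>), and temperedness bounds its growth. Finally, the
  subexponential growth of \<open>W\<close> is immediate if \<open>W\<close> is tempered; in general it holds almost
  surely, since by stationarity \<open>W\<close> almost surely returns to some ball along a sequence of times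
  tending to \<open>- \<infinity>\<close> (\<open>recurrently_bounded\<close>), and dissipativity turns a bound along a sequence
  into a bound at all times (\<open>averaged_solution_subexp_past\<close>).
\<close>

section \<open>Pathwise calculus on the real line\<close>

text \<open>One of the two integrals is always over a null interval; together they are the oriented
  integral from \<open>0\<close> to \<open>t\<close>, without a case distinction.\<close>

lemma antiderivative_on_reals:
  fixes z :: "real \<Rightarrow> real"
  assumes z: "continuous_on UNIV z"
  defines "A \<equiv> \<lambda>t. integral {0..t} z - integral {t..0} z"
  shows "(A has_real_derivative z t) (at t)"
proof -
  define N where "N = \<bar>t\<bar> + 1"
  have N: "N > 0" "-N < t" "t < N" by (auto simp: N_def)
  have int: "z integrable_on {a..b}" for a b
    using z by (intro integrable_continuous_interval) (auto intro: continuous_on_subset)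
  have "((\<lambda>s. integral {-N..s} z) has_vector_derivative z t) (at t within {-N..N})"
    using N z by (intro integral_has_vector_derivative) (auto intro: continuous_on_subset)
  then have "((\<lambda>s. integral {-N..s} z) has_real_derivative z t) (at t)"
    using N by (simp add: has_real_derivative_iff_has_vector_derivative at_within_Icc_at)
  then have d: "((\<lambda>s. integral {-N..s} z - integral {-N..0} z) has_real_derivative z t) (at t)"
    by (auto intro!: derivative_eq_intros)
  have eq: "integral {-N..s} z - integral {-N..0} z = A s" if "s \<in> {-N<..<N}" for s
  proof (cases "s \<ge> 0")
    case True
    then have "integral {s..0} z = 0" by (cases "s = 0") auto
    moreover have "integral {-N..0} z + integral {0..s} z = integral {-N..s} z"
      using True N int by (intro Henstock_Kurzweil_Integration.integral_combine) auto
    ultimately show ?thesis by (simp add: A_def)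
  next
    case False
    then have "integral {-N..s} z + integral {s..0} z = integral {-N..0} z"
      using that int by (intro Henstock_Kurzweil_Integration.integral_combine) auto
    then show ?thesis using False by (simp add: A_def)
  qed
  show ?thesis
    by (rule has_field_derivative_transform_within_open[OF d, of "{-N<..<N}"]) (use N eq in auto)
qed

lemma bounded_above_on_past:
  fixes f :: "real \<Rightarrow> real"
  assumes "continuous_on UNIV f" and "eventually (\<lambda>t. f t \<le> B) at_bot"
  shows "\<exists>K. \<forall>t\<le>T. f t \<le> K"
proof -
  obtain N where N: "\<And>t. t \<le> N \<Longrightarrow> f t \<le> B" using assms(2) by (auto simp: eventually_at_bot_linorder)
  have "bounded (f ` {N..T})"
    using assms(1) by (intro compact_imp_bounded compact_continuous_image) (auto intro: continuous_on_subset)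
  then obtain K where K: "\<And>t. t \<in> {N..T} \<Longrightarrow> \<bar>f t\<bar> \<le> K" unfolding bounded_iff by fastforce
  have "f t \<le> max B K" if "t \<le> T" for t
    using N[of t] K[of t] that by (cases "t \<le> N") auto
  then show ?thesis by blast
qed

lemma nonincreasing_of_deriv_nonpos:
  fixes f :: "real \<Rightarrow> real"
  assumes "a \<le> b" "\<And>t. a \<le> t \<Longrightarrow> t \<le> b \<Longrightarrow> \<exists>D. (f has_real_derivative D) (at t) \<and> D \<le> 0"
  shows "f b \<le> f a"
  using DERIV_nonpos_imp_nonincreasing[of a b f] assms by blast

text \<open>Adding and subtracting \<open>2 C e\<^bsup>t/2\<^esup>\<close>, whose derivative dominates \<open>A'\<close>, gives one
  nondecreasing and one nonincreasing function; the first is bounded below by means of the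
  second, and the correction vanishes at \<open>- \<infinity>\<close>.\<close>

lemma convergent_at_bot_of_exponential_decay:
  fixes A :: "real \<Rightarrow> real"
  assumes A: "\<And>t. (A has_real_derivative A' t) (at t)"
    and bound: "\<And>t. t \<le> 0 \<Longrightarrow> \<bar>A' t\<bar> \<le> C * exp (t / 2)"
  shows "\<exists>l. (A \<longlongrightarrow> l) at_bot"
proof -
  define u where "u t = A t + 2 * C * exp (t / 2)" for t
  have up: "u s \<le> u t" if "s \<le> t" "t \<le> 0" for s t
  proof -
    have "- u t \<le> - u s"
    proof (rule nonincreasing_of_deriv_nonpos[OF that(1)])
      fix r assume "s \<le> r" "r \<le> t"
      then have "\<bar>A' r\<bar> \<le> C * exp (r / 2)" using bound that by auto
      moreover have "((\<lambda>t. - u t) has_real_derivative - (A' r + C * exp (r / 2))) (at r)"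
        unfolding u_def by (auto intro!: derivative_eq_intros A)
      ultimately show "\<exists>D. ((\<lambda>t. - u t) has_real_derivative D) (at r) \<and> D \<le> 0" by fastforce
    qed
    then show ?thesis by simp
  qed
  have "C \<ge> 0" using bound[of 0] by auto
  have low: "A 0 - 2 * C \<le> u s" if "s \<le> 0" for s
  proof -
    have "A 0 - 2 * C * exp (0 / 2) \<le> A s - 2 * C * exp (s / 2)"
    proof (rule nonincreasing_of_deriv_nonpos[OF that])
      fix r assume "s \<le> r" "r \<le> 0"
      then have "\<bar>A' r\<bar> \<le> C * exp (r / 2)" using bound by auto
      moreover have "((\<lambda>t. A t - 2 * C * exp (t / 2)) has_real_derivative (A' r - C * exp (r / 2))) (at r)"
        by (auto intro!: derivative_eq_intros A)
      ultimately show "\<exists>D. ((\<lambda>t. A t - 2 * C * exp (t / 2)) has_real_derivative D) (at r) \<and> D \<le> 0"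
        by fastforce
    qed
    moreover have "0 \<le> 4 * C * exp (s / 2)" using \<open>C \<ge> 0\<close> by simp
    ultimately show ?thesis by (simp add: u_def)
  qed
  have bdd: "bdd_below (u ` {..0})" using low by (auto intro!: bdd_belowI)
  have "(u \<longlongrightarrow> Inf (u ` {..0})) at_bot"
  proof (rule decreasing_tendsto)
    show "eventually (\<lambda>n. Inf (u ` {..0}) \<le> u n) at_bot"
      using bdd by (auto simp: eventually_at_bot_linorder intro!: exI[of _ 0] cInf_lower)
  next
    fix x assume "Inf (u ` {..0}) < x"
    then obtain s where s: "s \<le> 0" "u s < x" using bdd by (subst (asm) cInf_less_iff) auto
    then have "u n < x" if "n \<le> s" for n using up[of n s] that by auto
    then show "eventually (\<lambda>n. u n < x) at_bot" by (auto simp: eventually_at_bot_linorder)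
  qed
  moreover have "((\<lambda>t. 2 * C * exp (t / 2)) \<longlongrightarrow> 2 * C * 0) at_bot"
    by (intro tendsto_mult_left) real_asymp
  ultimately have "((\<lambda>t. u t - 2 * C * exp (t / 2)) \<longlongrightarrow> Inf (u ` {..0}) - 2 * C * 0) at_bot"
    by (rule tendsto_diff)
  then show ?thesis by (auto simp: u_def)
qed


section \<open>The Ornstein--Uhlenbeck path of a continuous path\<close>

text \<open>With \<open>A' = e\<^sup>t x\<close>, the function \<open>t \<mapsto> e\<^sup>t x(t) - A(t)\<close> is formally an
  antiderivative of \<open>e\<^sup>t dx(t)\<close>. Although \<open>x\<close> need not have bounded variation, a single term
  of a Riemann--Stieltjes sum differs from the increment of this function only by the
  oscillation of \<open>x\<close> times the increment of \<open>exp\<close>: split at the tag \<open>s\<close> and compare \<open>x\<close> with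
  \<open>x c\<close> to the left of it and with \<open>x d\<close> to the right.\<close>

lemma exp_tagged_term_error:
  fixes x A :: "real \<Rightarrow> real"
  assumes A: "\<And>t. (A has_real_derivative exp t * x t) (at t)"
    and s: "c \<le> s" "s \<le> d"
    and osc: "\<And>r r'. r \<in> {c..d} \<Longrightarrow> r' \<in> {c..d} \<Longrightarrow> \<bar>x r - x r'\<bar> \<le> e"
  shows "\<bar>exp s * (x d - x c) - ((exp d * x d - A d) - (exp c * x c - A c))\<bar> \<le> e * (exp d - exp c)"
proof -
  have *: "\<bar>(A q - exp q * x r) - (A p - exp p * x r)\<bar> \<le> e * (exp q - exp p)"
    if "c \<le> p" "p \<le> q" "q \<le> d" "r \<in> {c..d}" for p q r
  proof -
    have "\<sigma> * (A q - exp q * x r) - e * exp q \<le> \<sigma> * (A p - exp p * x r) - e * exp p"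
      if sg: "\<bar>\<sigma>\<bar> = 1" for \<sigma>
    proof (rule nonincreasing_of_deriv_nonpos[OF \<open>p \<le> q\<close>])
      fix t assume "p \<le> t" "t \<le> q"
      then have "\<bar>x t - x r\<bar> \<le> e" using osc[of t r] that \<open>c \<le> p\<close> \<open>q \<le> d\<close> \<open>r \<in> _\<close> by auto
      then have "\<sigma> * (x t - x r) \<le> e" using sg by (smt (verit) mult_cancel_right1 mult_minus_left)
      then have "exp t * (\<sigma> * (x t - x r) - e) \<le> 0" by (intro mult_nonneg_nonpos) auto
      moreover have "((\<lambda>q. \<sigma> * (A q - exp q * x r) - e * exp q) has_real_derivative
          exp t * (\<sigma> * (x t - x r) - e)) (at t)"
        by (auto intro!: derivative_eq_intros A simp: algebra_simps)
      ultimately show "\<exists>D. ((\<lambda>q. \<sigma> * (A q - exp q * x r) - e * exp q) has_real_derivative D) (at t) \<and> D \<le> 0"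
        by blast
    qed
    from this[of 1] this[of "-1"] show ?thesis by (auto simp: abs_le_iff algebra_simps)
  qed
  have "exp s * (x d - x c) - ((exp d * x d - A d) - (exp c * x c - A c)) =
    ((A d - exp d * x d) - (A s - exp s * x d)) + ((A s - exp s * x c) - (A c - exp c * x c))"
    by (simp add: algebra_simps)
  then show ?thesis
    using *[of s d d] *[of c s c] s by (simp add: algebra_simps abs_le_iff)
qed

text \<open>The increments of the formal antiderivative and those of \<open>exp\<close> both telescope over a tagged
  division, so the total error is at most the modulus of continuity of \<open>x\<close> times \<open>e\<^sup>b - e\<^sup>a\<close>.\<close>

lemma has_RS_integral_exp:
  fixes x A :: "real \<Rightarrow> real"
  assumes x: "continuous_on UNIV x"
    and A: "\<And>t. (A has_real_derivative exp t * x t) (at t)"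
    and ab: "a \<le> b"
  shows "has_RS_integral exp x a b ((exp b * x b - A b) - (exp a * x a - A a))"
  unfolding has_RS_integral_def
proof (intro allI impI)
  fix e :: real assume e: "e > 0"
  define \<Phi> where "\<Phi> t = exp t * x t - A t" for t
  define \<eta> where "\<eta> = e / (exp b - exp a + 1)"
  have pos: "exp b - exp a + 1 > 0" using ab by (simp add: add_strict_increasing2)
  have \<eta>: "\<eta> > 0" "\<eta> * (exp b - exp a) < e"
    using e pos by (auto simp: \<eta>_def field_simps)
  have "uniformly_continuous_on {a..b} x"
    using x by (intro compact_uniformly_continuous) (auto intro: continuous_on_subset)
  then obtain \<delta> where \<delta>: "\<delta> > 0"
    "\<And>r r'. r \<in> {a..b} \<Longrightarrow> r' \<in> {a..b} \<Longrightarrow> dist r' r < \<delta> \<Longrightarrow> dist (x r') (x r) < \<eta>"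
    using \<eta>(1) unfolding uniformly_continuous_on_def by metis
  show "\<exists>\<delta>>0. \<forall>D. D tagged_division_of {a..b} \<and> (\<forall>(s, K)\<in>D. diameter K < \<delta>) \<longrightarrow>
        \<bar>(\<Sum>(s, K)\<in>D. exp s * (x (Sup K) - x (Inf K))) -
          ((exp b * x b - A b) - (exp a * x a - A a))\<bar> < e"
  proof (intro exI conjI allI impI)
    fix D assume D: "D tagged_division_of {a..b} \<and> (\<forall>(s, K)\<in>D. diameter K < \<delta>)"
    have part: "\<bar>exp s * (x (Sup K) - x (Inf K)) - (\<Phi> (Sup K) - \<Phi> (Inf K))\<bar>
        \<le> \<eta> * (exp (Sup K) - exp (Inf K))" if K: "(s, K) \<in> D" for s K
    proof -
      obtain c d where cd: "K = cbox c d" using D K tagged_division_ofD(4) by blast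
      have sK: "s \<in> K" "K \<subseteq> {a..b}" using D K tagged_division_ofD(2,3) by blast+
      then have le: "c \<le> s" "s \<le> d" by (auto simp: cd)
      then have K': "K = {c..d}" "Sup K = d" "Inf K = c" by (auto simp: cd)
      have "d - c < \<delta>" using D K le by (auto simp: K' diameter_closed_interval)
      then have osc: "\<bar>x r - x r'\<bar> \<le> \<eta>" if "r \<in> {c..d}" "r' \<in> {c..d}" for r r'
        using \<delta>(2)[of r' r] that sK by (force simp: K' dist_real_def)
      show ?thesis
        unfolding K'(2,3) \<Phi>_def by (rule exp_tagged_term_error[OF A le osc])
    qed
    have "(\<Sum>(s, K)\<in>D. exp s * (x (Sup K) - x (Inf K))) - (\<Phi> b - \<Phi> a) =
        (\<Sum>(s, K)\<in>D. exp s * (x (Sup K) - x (Inf K)) - (\<Phi> (Sup K) - \<Phi> (Inf K)))"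
      using additive_tagged_division_1[OF ab, of D \<Phi>] D
      by (simp add: sum_subtractf case_prod_unfold)
    also have "\<bar>\<dots>\<bar> \<le> (\<Sum>(s, K)\<in>D. \<eta> * (exp (Sup K) - exp (Inf K)))"
      using part by (intro order_trans[OF sum_abs] sum_mono) auto
    also have "\<dots> = \<eta> * (exp b - exp a)"
      using additive_tagged_division_1[OF ab, of D exp] D
      by (simp add: sum_distrib_left[symmetric] case_prod_unfold)
    finally show "\<bar>(\<Sum>(s, K)\<in>D. exp s * (x (Sup K) - x (Inf K))) -
          ((exp b * x b - A b) - (exp a * x a - A a))\<bar> < e"
      using \<eta>(2) by (simp add: \<Phi>_def)
  qed (rule \<delta>(1))
qed

lemma has_RS_integral_unique:
  assumes "has_RS_integral h x a b I" "has_RS_integral h x a b J"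
  shows "I = J"
proof (rule ccontr)
  assume "I \<noteq> J"
  define e where "e = \<bar>I - J\<bar> / 2"
  have e: "e > 0" using \<open>I \<noteq> J\<close> by (simp add: e_def)
  obtain d1 where d1: "d1 > 0" "\<forall>D. D tagged_division_of {a..b} \<and> (\<forall>(s, K)\<in>D. diameter K < d1) \<longrightarrow>
        \<bar>(\<Sum>(s, K)\<in>D. h s * (x (Sup K) - x (Inf K))) - I\<bar> < e"
    using assms(1)[unfolded has_RS_integral_def, rule_format, OF e] by (elim exE conjE)
  obtain d2 where d2: "d2 > 0" "\<forall>D. D tagged_division_of {a..b} \<and> (\<forall>(s, K)\<in>D. diameter K < d2) \<longrightarrow>
        \<bar>(\<Sum>(s, K)\<in>D. h s * (x (Sup K) - x (Inf K))) - J\<bar> < e"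
    using assms(2)[unfolded has_RS_integral_def, rule_format, OF e] by (elim exE conjE)
  define d where "d = min d1 d2 / 4"
  have d: "d > 0" using d1 d2 by (simp add: d_def)
  obtain D where D: "D tagged_division_of cbox a b" "(\<lambda>s. ball s d) fine D"
    using fine_division_exists[OF gauge_ball[OF d], of a b] by blast
  have diam: "diameter K < min d1 d2" if "(s, K) \<in> D" for s K
  proof -
    have "K \<subseteq> ball s d" using D(2) that by (auto simp: fine_def)
    then have "diameter K \<le> diameter (ball s d)" by (intro diameter_subset) auto
    also have "\<dots> \<le> 2 * d" using d by (simp add: diameter_ball)
    finally show ?thesis using d by (simp add: d_def)
  qed
  then have "\<forall>(s, K)\<in>D. diameter K < d1" "\<forall>(s, K)\<in>D. diameter K < d2" by fastforce+
  then have "\<bar>(\<Sum>(s, K)\<in>D. h s * (x (Sup K) - x (Inf K))) - I\<bar> < e"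
    "\<bar>(\<Sum>(s, K)\<in>D. h s * (x (Sup K) - x (Inf K))) - J\<bar> < e"
    using D(1) d1(2)[rule_format, of D] d2(2)[rule_format, of D] by simp_all
  then show False unfolding e_def by argo
qed

lemma fOU_eq:
  fixes x A :: "real \<Rightarrow> real"
  assumes x: "continuous_on UNIV x" "((\<lambda>a. exp a * x a) \<longlongrightarrow> 0) at_bot"
    and A: "\<And>t. (A has_real_derivative exp t * x t) (at t)" "(A \<longlongrightarrow> 0) at_bot"
  shows "fOU x t = x t - exp (- t) * A t"
proof -
  have "((\<lambda>a. (exp t * x t - A t) - (exp a * x a - A a)) \<longlongrightarrow> (exp t * x t - A t) - (0 - 0)) at_bot"
    by (intro tendsto_intros x A)
  moreover have "eventually (\<lambda>a. (exp t * x t - A t) - (exp a * x a - A a) = RS_integral exp x a t) at_bot"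
    using eventually_le_at_bot[of t]
  proof eventually_elim
    case (elim a)
    note I = has_RS_integral_exp[OF x(1) A(1) elim]
    show ?case unfolding RS_integral_def
      by (rule the_equality[symmetric]) (use I has_RS_integral_unique in blast)+
  qed
  ultimately have "((\<lambda>a. RS_integral exp x a t) \<longlongrightarrow> exp t * x t - A t) at_bot"
    by (subst (asm) tendsto_cong) (auto elim: eventually_mono)
  then have "Lim at_bot (\<lambda>a. RS_integral exp x a t) = exp t * x t - A t"
    by (intro tendsto_Lim) auto
  then show ?thesis by (simp add: fOU_def exp_minus field_simps)
qed

text \<open>Sublinear growth makes \<open>e\<^sup>t x(t)\<close> integrable at \<open>- \<infinity>\<close>, which allows the normalization
  \<open>A(- \<infinity>) = 0\<close>; this \<open>A\<close> is \<open>t \<mapsto> \<integral>\<^bsub>-\<infinity>\<^esub>\<^bsup>t\<^esup> e\<^sup>s x(s) ds\<close>.\<close>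

lemma sublinear_antiderivative:
  fixes x :: "real \<Rightarrow> real"
  assumes x: "continuous_on UNIV x" "((\<lambda>t. x t / t) \<longlongrightarrow> 0) at_infinity"
  obtains A where "((\<lambda>a. exp a * x a) \<longlongrightarrow> 0) at_bot"
    "\<And>t. (A has_real_derivative exp t * x t) (at t)" "(A \<longlongrightarrow> 0) at_bot"
proof -
  have lim: "((\<lambda>t. x t / t) \<longlongrightarrow> 0) at_bot" using x(2) at_bot_le_at_infinity by (rule tendsto_mono[rotated])
  have "((\<lambda>a. (x a / a) * (a * exp a)) \<longlongrightarrow> 0 * 0) at_bot"
    by (intro tendsto_mult lim) real_asymp
  moreover have "eventually (\<lambda>a. (x a / a) * (a * exp a) = exp a * x a) at_bot"
    using eventually_gt_at_bot[of 0] by eventually_elim auto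
  ultimately have 1: "((\<lambda>a. exp a * x a) \<longlongrightarrow> 0) at_bot" by (simp add: tendsto_cong)
  have "((\<lambda>a. (x a / a) * (a * exp (a / 2))) \<longlongrightarrow> 0 * 0) at_bot"
    by (intro tendsto_mult lim) real_asymp
  moreover have "eventually (\<lambda>a. (x a / a) * (a * exp (a / 2)) = exp (a / 2) * x a) at_bot"
    using eventually_gt_at_bot[of 0] by eventually_elim auto
  ultimately have "((\<lambda>a. exp (a / 2) * x a) \<longlongrightarrow> 0) at_bot" by (simp add: tendsto_cong)
  then have "eventually (\<lambda>a. \<bar>exp (a / 2) * x a\<bar> \<le> 1) at_bot"
    by (auto dest!: tendstoD[where e = 1] elim!: eventually_mono simp: dist_real_def)
  then obtain C where C: "\<And>t. t \<le> 0 \<Longrightarrow> \<bar>exp (t / 2) * x t\<bar> \<le> C"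
    using bounded_above_on_past[of "\<lambda>a. \<bar>exp (a / 2) * x a\<bar>" 1 0] x(1)
    by (force intro!: continuous_intros)
  have "continuous_on UNIV (\<lambda>t. exp t * x t)" using x(1) by (intro continuous_intros)
  then obtain A where A: "\<And>t. (A has_real_derivative exp t * x t) (at t)"
    using antiderivative_on_reals by blast
  have "\<bar>exp t * x t\<bar> \<le> C * exp (t / 2)" if "t \<le> 0" for t
  proof -
    have "exp t * x t = (exp (t / 2) * x t) * exp (t / 2)"
      using exp_add[of "t / 2" "t / 2"] by simp
    then have "\<bar>exp t * x t\<bar> = \<bar>exp (t / 2) * x t\<bar> * exp (t / 2)" by (simp only: abs_mult) simp
    then show ?thesis using C[OF that] by (metis mult_right_mono exp_ge_zero)
  qed
  from convergent_at_bot_of_exponential_decay[OF A this]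
  obtain l where l: "(A \<longlongrightarrow> l) at_bot" by auto
  show thesis
  proof (rule that[OF 1])
    show "((\<lambda>t. A t - l) has_real_derivative exp t * x t) (at t)" for t
      by (auto intro!: derivative_eq_intros A)
    show "((\<lambda>t. A t - l) \<longlongrightarrow> 0) at_bot" using l by (auto intro!: tendsto_eq_intros)
  qed
qed

lemma continuous_on_fOU:
  assumes x: "continuous_on UNIV x" "((\<lambda>t. x t / t) \<longlongrightarrow> 0) at_infinity"
  shows "continuous_on UNIV (fOU x)"
proof -
  obtain A where A: "((\<lambda>a. exp a * x a) \<longlongrightarrow> 0) at_bot"
    "\<And>t. (A has_real_derivative exp t * x t) (at t)" "(A \<longlongrightarrow> 0) at_bot"
    using sublinear_antiderivative[OF x] by blast
  have "continuous_on UNIV A"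
    using A(2) by (meson DERIV_isCont continuous_at_imp_continuous_on)
  then show ?thesis
    unfolding fOU_eq[OF x(1) A(1) A(2) A(3), abs_def] by (intro continuous_intros x)
qed

text \<open>The shifted path is continuous, and its normalized antiderivative is an explicit expression
  in that of \<open>x\<close>; the constant \<open>x \<tau>\<close> cancels because \<open>exp\<close> is its own normalized
  antiderivative.\<close>

lemma fOU_shift:
  assumes x: "continuous_on UNIV x" "((\<lambda>t. x t / t) \<longlongrightarrow> 0) at_infinity"
  shows "fOU (\<lambda>s. x (s + \<tau>) - x \<tau>) s = fOU x (s + \<tau>)"
proof -
  obtain A where A: "((\<lambda>a. exp a * x a) \<longlongrightarrow> 0) at_bot"
    "\<And>t. (A has_real_derivative exp t * x t) (at t)" "(A \<longlongrightarrow> 0) at_bot"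
    using sublinear_antiderivative[OF x] by blast
  define B where "B s = exp (- \<tau>) * A (s + \<tau>) - x \<tau> * exp s" for s
  have sh: "filterlim (\<lambda>s. s + \<tau>) at_bot at_bot" for \<tau> :: real
    by real_asymp
  have e: "exp a * (x (a + \<tau>) - x \<tau>) = exp (- \<tau>) * (exp (a + \<tau>) * x (a + \<tau>)) - exp a * x \<tau>" for a
    by (simp add: exp_add exp_minus algebra_simps)
  have "fOU (\<lambda>s. x (s + \<tau>) - x \<tau>) s = (x (s + \<tau>) - x \<tau>) - exp (- s) * B s"
  proof (rule fOU_eq)
    show "continuous_on UNIV (\<lambda>s. x (s + \<tau>) - x \<tau>)"
      by (intro continuous_intros continuous_on_compose2[OF x(1)]) auto
    have "((\<lambda>a. exp (- \<tau>) * (exp (a + \<tau>) * x (a + \<tau>)) - exp a * x \<tau>) \<longlongrightarrow> exp (- \<tau>) * 0 - 0 * x \<tau>) at_bot"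
      by (intro tendsto_intros filterlim_compose[OF A(1) sh] exp_at_bot)
    then show "((\<lambda>a. exp a * (x (a + \<tau>) - x \<tau>)) \<longlongrightarrow> 0) at_bot" by (simp add: e)
    show "(B has_real_derivative exp t * (x (t + \<tau>) - x \<tau>)) (at t)" for t
    proof -
      have "((\<lambda>s. A (s + \<tau>)) has_real_derivative exp (t + \<tau>) * x (t + \<tau>)) (at t)"
      proof -
        have "((\<lambda>s. s + \<tau>) has_real_derivative 1) (at t)" by (auto intro!: derivative_eq_intros)
        from DERIV_chain2[OF A(2) this] show ?thesis by simp
      qed
      then show ?thesis unfolding B_def[abs_def]
        by (auto intro!: derivative_eq_intros simp: e)
    qed
    have "((\<lambda>s. exp (- \<tau>) * A (s + \<tau>) - x \<tau> * exp s) \<longlongrightarrow> exp (- \<tau>) * 0 - x \<tau> * 0) at_bot"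
      by (intro tendsto_intros filterlim_compose[OF A(3) sh] exp_at_bot)
    then show "(B \<longlongrightarrow> 0) at_bot" by (simp add: B_def[abs_def])
  qed
  also have "\<dots> = fOU x (s + \<tau>)"
  proof -
    have "exp (- s) * (x \<tau> * exp s) = x \<tau>" by (simp add: exp_minus)
    moreover have "exp (- (s + \<tau>)) = exp (- s) * exp (- \<tau>)" by (simp add: exp_add[symmetric])
    ultimately show ?thesis
      unfolding fOU_eq[OF x(1) A(1) A(2) A(3)] B_def by (simp add: right_diff_distrib)
  qed
  finally show ?thesis .
qed


section \<open>Subexponential growth in the past\<close>

text \<open>Growth is restricted only towards \<open>- \<infinity>\<close>; the bound on every half-line \<open>{..T}\<close>, rather
  than just eventually, spares the later estimates a separate treatment of compact intervals.
  The functions are meant to be nonnegative.\<close>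

definition subexp_past :: "(real \<Rightarrow> real) \<Rightarrow> bool" where
  "subexp_past y \<longleftrightarrow> (\<forall>e>0. \<forall>T. \<exists>C\<ge>0. \<forall>t\<le>T. y t \<le> C * exp (e * \<bar>t\<bar>))"

lemma subexp_pastI:
  assumes "continuous_on UNIV y" and "\<And>e. e > 0 \<Longrightarrow> eventually (\<lambda>t. y t \<le> exp (e * \<bar>t\<bar>)) at_bot"
  shows "subexp_past y"
  unfolding subexp_past_def
proof (intro allI impI)
  fix e T :: real assume e: "e > 0"
  have "eventually (\<lambda>t. y t * exp (- e * \<bar>t\<bar>) \<le> 1) at_bot"
    using assms(2)[OF e] by eventually_elim (simp add: exp_minus field_simps)
  then obtain K where K: "\<And>t. t \<le> T \<Longrightarrow> y t * exp (- e * \<bar>t\<bar>) \<le> K"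
    using bounded_above_on_past[of "\<lambda>t. y t * exp (- e * \<bar>t\<bar>)" 1 T] assms(1)
    by (force intro!: continuous_intros)
  have "y t \<le> max 0 K * exp (e * \<bar>t\<bar>)" if "t \<le> T" for t
  proof -
    have "y t \<le> K * exp (e * \<bar>t\<bar>)" using K[OF that] by (simp add: exp_minus field_simps)
    also have "\<dots> \<le> max 0 K * exp (e * \<bar>t\<bar>)" by (intro mult_right_mono) auto
    finally show ?thesis .
  qed
  then show "\<exists>C\<ge>0. \<forall>t\<le>T. y t \<le> C * exp (e * \<bar>t\<bar>)" by (intro exI[of _ "max 0 K"]) auto
qed

lemma subexp_pastE:
  assumes "subexp_past y" "e > 0"
  obtains C where "C \<ge> 0" "\<And>t. t \<le> T \<Longrightarrow> y t \<le> C * exp (e * \<bar>t\<bar>)"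
  using assms unfolding subexp_past_def by blast

lemma subexp_past_mono:
  assumes "subexp_past y" "\<And>t. x t \<le> y t"
  shows "subexp_past x"
  using assms unfolding subexp_past_def by (meson order_trans)

lemma subexp_past_const: "subexp_past (\<lambda>t. c)"
  unfolding subexp_past_def
proof (intro allI impI exI conjI)
  fix e T t :: real assume "e > 0"
  then have "\<bar>c\<bar> * 1 \<le> \<bar>c\<bar> * exp (e * \<bar>t\<bar>)" by (intro mult_left_mono) auto
  then show "c \<le> \<bar>c\<bar> * exp (e * \<bar>t\<bar>)" by simp
qed simp

lemma subexp_past_add:
  assumes "subexp_past x" "subexp_past y"
  shows "subexp_past (\<lambda>t. x t + y t)"
  unfolding subexp_past_def
proof (intro allI impI)
  fix e T :: real assume e: "e > 0"
  obtain C where C: "C \<ge> 0" "\<And>t. t \<le> T \<Longrightarrow> x t \<le> C * exp (e * \<bar>t\<bar>)" using assms(1) e by (rule subexp_pastE[where T = T]) blast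
  obtain D where D: "D \<ge> 0" "\<And>t. t \<le> T \<Longrightarrow> y t \<le> D * exp (e * \<bar>t\<bar>)" using assms(2) e by (rule subexp_pastE[where T = T]) blast
  show "\<exists>C\<ge>0. \<forall>t\<le>T. x t + y t \<le> C * exp (e * \<bar>t\<bar>)"
    using C D by (intro exI[of _ "C + D"]) (auto simp: distrib_right add_mono)
qed

lemma subexp_past_mult:
  assumes "subexp_past x" "subexp_past y" "\<And>t. 0 \<le> x t" "\<And>t. 0 \<le> y t"
  shows "subexp_past (\<lambda>t. x t * y t)"
  unfolding subexp_past_def
proof (intro allI impI)
  fix e T :: real assume "e > 0"
  then have e: "e / 2 > 0" by simp
  obtain C where C: "C \<ge> 0" "\<And>t. t \<le> T \<Longrightarrow> x t \<le> C * exp (e / 2 * \<bar>t\<bar>)" using assms(1) e by (rule subexp_pastE[where T = T]) blast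
  obtain D where D: "D \<ge> 0" "\<And>t. t \<le> T \<Longrightarrow> y t \<le> D * exp (e / 2 * \<bar>t\<bar>)" using assms(2) e by (rule subexp_pastE[where T = T]) blast
  have "x t * y t \<le> C * D * exp (e * \<bar>t\<bar>)" if "t \<le> T" for t
  proof -
    have "x t * y t \<le> (C * exp (e / 2 * \<bar>t\<bar>)) * (D * exp (e / 2 * \<bar>t\<bar>))"
      using C D that assms(3,4) by (intro mult_mono) auto
    also have "\<dots> = C * D * (exp (e / 2 * \<bar>t\<bar>) * exp (e / 2 * \<bar>t\<bar>))" by simp
    also have "exp (e / 2 * \<bar>t\<bar>) * exp (e / 2 * \<bar>t\<bar>) = exp (e * \<bar>t\<bar>)"
      unfolding exp_add[symmetric] by (rule arg_cong[of _ _ exp]) (simp add: field_simps)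
    finally show ?thesis .
  qed
  then show "\<exists>C\<ge>0. \<forall>t\<le>T. x t * y t \<le> C * exp (e * \<bar>t\<bar>)"
    using C(1) D(1) by (intro exI[of _ "C * D"]) auto
qed

lemma subexp_past_exp_sublinear:
  fixes z :: "real \<Rightarrow> real"
  assumes z: "continuous_on UNIV z" "((\<lambda>t. z t / t) \<longlongrightarrow> 0) at_infinity"
  shows "subexp_past (\<lambda>t. exp (c * \<bar>z t\<bar>))"
proof (rule subexp_pastI)
  show "continuous_on UNIV (\<lambda>t. exp (c * \<bar>z t\<bar>))" by (intro continuous_intros z)
  fix e :: real assume e: "e > 0"
  define d where "d = e / (\<bar>c\<bar> + 1)"
  have d: "d > 0" "\<bar>c\<bar> * d \<le> e" using e by (auto simp: d_def field_simps add_pos_nonneg)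
  have "((\<lambda>t. z t / t) \<longlongrightarrow> 0) at_bot" using z(2) at_bot_le_at_infinity by (rule tendsto_mono[rotated])
  then have "eventually (\<lambda>t. \<bar>z t / t\<bar> < d) at_bot" using tendstoD[OF _ d(1)] by (fastforce simp: dist_real_def)
  then show "eventually (\<lambda>t. exp (c * \<bar>z t\<bar>) \<le> exp (e * \<bar>t\<bar>)) at_bot"
    using eventually_gt_at_bot[of 0]
  proof eventually_elim
    case (elim t)
    then have "\<bar>z t\<bar> \<le> d * \<bar>t\<bar>" by (simp add: abs_divide field_simps)
    then have "\<bar>c\<bar> * \<bar>z t\<bar> \<le> \<bar>c\<bar> * (d * \<bar>t\<bar>)" by (intro mult_left_mono) auto
    also have "\<dots> \<le> e * \<bar>t\<bar>" using d(2) mult_right_mono[of "\<bar>c\<bar> * d" e "\<bar>t\<bar>"] by (simp add: mult.assoc)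
    finally have "\<bar>c\<bar> * \<bar>z t\<bar> \<le> e * \<bar>t\<bar>" .
    moreover have "c * \<bar>z t\<bar> \<le> \<bar>c\<bar> * \<bar>z t\<bar>" by (intro mult_right_mono) auto
    ultimately show ?case by simp
  qed
qed


section \<open>Comparison with the remote past\<close>

lemma exponent_close_to_linear:
  fixes P :: "real \<Rightarrow> real"
  assumes P: "continuous_on UNIV P" "((\<lambda>t. P t / t) \<longlongrightarrow> - \<mu>) at_bot" and d: "\<delta> > 0"
  shows "\<exists>K. \<forall>t\<le>T. \<bar>P t + \<mu> * t\<bar> \<le> K + \<delta> * \<bar>t\<bar>"
proof -
  have "eventually (\<lambda>t. \<bar>P t / t + \<mu>\<bar> < \<delta>) at_bot" using tendstoD[OF P(2) d] by (simp add: dist_real_def)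
  then have "eventually (\<lambda>t. \<bar>P t + \<mu> * t\<bar> - \<delta> * \<bar>t\<bar> \<le> 0) at_bot"
    using eventually_gt_at_bot[of 0]
  proof eventually_elim
    case (elim t)
    then have "\<bar>P t + \<mu> * t\<bar> = \<bar>P t / t + \<mu>\<bar> * \<bar>t\<bar>"
      unfolding abs_mult[symmetric] by (simp add: distrib_right)
    also have "\<dots> \<le> \<delta> * \<bar>t\<bar>" using elim by (intro mult_right_mono) auto
    finally show ?case by simp
  qed
  then have "\<exists>K. \<forall>t\<le>T. \<bar>P t + \<mu> * t\<bar> - \<delta> * \<bar>t\<bar> \<le> K"
    by (intro bounded_above_on_past continuous_intros P(1))
  then show ?thesis by (simp add: algebra_simps)
qed

text \<open>A Gronwall estimate started at \<open>- \<infinity>\<close>. The weight \<open>e\<^bsup>- P\<^esup>\<close> decays like \<open>e\<^bsup>\<mu> t\<^esup>\<close> towards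
  \<open>- \<infinity>\<close> and removes the linear term; the weighted forcing is dominated by \<open>c G' e\<^bsup>k t\<^esup>\<close> with
  \<open>k > 0\<close>, so subtracting \<open>(c G' / k) e\<^bsup>k t\<^esup>\<close> from \<open>e\<^bsup>- P\<^esup> y\<close> leaves a nonincreasing function.
  It is small at some arbitrarily early times, hence nonpositive everywhere. Smallness is
  asked for frequently rather than eventually, because recurrence of a stationary process
  gives no more than that. The constant does not depend on \<open>c\<close> and \<open>y\<close>, which is what makes
  the error proportional to \<open>1 / \<kappa>\<close>.\<close>

lemma pullback_comparison:
  fixes P r \<gamma> :: "real \<Rightarrow> real"
  assumes P: "\<And>t. (P has_real_derivative r t) (at t)" "((\<lambda>t. P t / t) \<longlongrightarrow> - \<mu>) at_bot" "\<mu> > 0"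
    and \<gamma>: "subexp_past \<gamma>" and e: "e > 0"
  shows "\<exists>C\<ge>0. \<forall>c y. 0 \<le> c \<longrightarrow>
      (\<forall>t. \<exists>D. (y has_real_derivative D) (at t) \<and> D \<le> r t * y t + c * \<gamma> t) \<longrightarrow>
      (\<forall>\<epsilon>>0. \<exists>\<^sub>F t in at_bot. exp (- P t) * y t < \<epsilon>) \<longrightarrow>
      (\<forall>t\<le>T. y t \<le> c * C * exp (e * \<bar>t\<bar>))"
proof -
  have contP: "continuous_on UNIV P" using P(1) by (meson DERIV_isCont continuous_at_imp_continuous_on)
  \<comment> \<open>\<open>P\<close> deviates from \<open>- \<mu> t\<close> by \<open>\<delta> |t|\<close>, once in the weighted forcing and once when the
    weight is undone, and \<open>\<gamma>\<close> costs another \<open>\<delta> |t|\<close>: in total \<open>3 \<delta> \<le> e\<close>. The bound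
    \<open>\<delta> \<le> \<mu> / 4\<close> keeps the exponent \<open>k\<close> positive.\<close>
  define \<delta> where "\<delta> = min (e / 3) (\<mu> / 4)"
  have \<delta>: "\<delta> > 0" "3 * \<delta> \<le> e" "\<mu> - 2 * \<delta> > 0" using e P(3) by (auto simp: \<delta>_def)
  define k where "k = \<mu> - 2 * \<delta>"
  have k: "k > 0" using \<delta>(3) by (simp add: k_def)
  obtain K where K: "\<And>t. t \<le> T \<Longrightarrow> \<bar>P t + \<mu> * t\<bar> \<le> K + \<delta> * \<bar>t\<bar>"
    using exponent_close_to_linear[OF contP P(2) \<delta>(1)] by blast
  obtain G where G: "G \<ge> 0" "\<And>t. t \<le> T \<Longrightarrow> \<gamma> t \<le> G * exp (\<delta> * \<bar>t\<bar>)"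
    using \<gamma> \<delta>(1) by (rule subexp_pastE[where T = T]) blast
  define G' where "G' = G * exp (K + 4 * \<delta> * \<bar>T\<bar>)"
  have G': "G' \<ge> 0" using G(1) by (simp add: G'_def)
  have decay: "exp (- P t) * \<gamma> t \<le> G' * exp (k * t)" if "t \<le> T" for t
  proof -
    have "exp (- P t) * \<gamma> t \<le> exp (- P t) * (G * exp (\<delta> * \<bar>t\<bar>))" using G(2)[OF that] by simp
    also have "\<dots> = G * exp (\<delta> * \<bar>t\<bar> - P t)" by (simp add: exp_add[symmetric])
    also have "\<dots> \<le> G * exp (K + 4 * \<delta> * \<bar>T\<bar> + k * t)"
    proof -
      \<comment> \<open>Equality with \<open>- t\<close> fails only on \<open>[0, T]\<close>; the term \<open>2 |T|\<close> covers that interval.\<close>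
      have "\<bar>t\<bar> \<le> 2 * \<bar>T\<bar> - t" using that by auto
      then have "2 * \<delta> * \<bar>t\<bar> \<le> 2 * \<delta> * (2 * \<bar>T\<bar> - t)" using \<delta>(1) by (intro mult_left_mono) auto
      moreover have "- P t \<le> K + \<delta> * \<bar>t\<bar> + \<mu> * t" using K[OF that] by linarith
      ultimately have "\<delta> * \<bar>t\<bar> - P t \<le> K + 4 * \<delta> * \<bar>T\<bar> + k * t" by (simp add: k_def algebra_simps)
      then show ?thesis using G(1) by (intro mult_left_mono) auto
    qed
    also have "\<dots> = G' * exp (k * t)" by (simp add: G'_def exp_add)
    finally show ?thesis .
  qed
  define C where "C = G' / k * exp (K + 4 * \<delta> * \<bar>T\<bar>)"
  have "y t \<le> c * C * exp (e * \<bar>t\<bar>)"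
    if c: "0 \<le> c" and y: "\<And>t. \<exists>D. (y has_real_derivative D) (at t) \<and> D \<le> r t * y t + c * \<gamma> t"
      and small: "\<And>\<epsilon>. \<epsilon> > 0 \<Longrightarrow> \<exists>\<^sub>F t in at_bot. exp (- P t) * y t < \<epsilon>" and t: "t \<le> T" for c y t
  proof -
    define Z where "Z s = exp (- P s) * y s - c * G' / k * exp (k * s)" for s
    have mono: "Z t \<le> Z s" if "s \<le> t" for s
    proof (rule nonincreasing_of_deriv_nonpos[OF that])
      fix q assume q: "s \<le> q" "q \<le> t"
      obtain D where D: "(y has_real_derivative D) (at q)" "D \<le> r q * y q + c * \<gamma> q" using y by blast
      have "(Z has_real_derivative (exp (- P q) * (D - r q * y q) - c * (G' * exp (k * q)))) (at q)"
        unfolding Z_def[abs_def] using k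
        by (auto intro!: derivative_eq_intros P(1) D(1) simp: algebra_simps)
      moreover have "exp (- P q) * (D - r q * y q) \<le> exp (- P q) * (c * \<gamma> q)"
        using D(2) by (intro mult_left_mono) auto
      moreover have "c * (exp (- P q) * \<gamma> q) \<le> c * (G' * exp (k * q))"
        using decay[of q] q t c by (intro mult_left_mono) auto
      ultimately show "\<exists>D. (Z has_real_derivative D) (at q) \<and> D \<le> 0"
        by (intro exI conjI) (auto simp: algebra_simps)
    qed
    have "Z t \<le> 0"
    proof (rule field_le_epsilon)
      fix \<epsilon> :: real assume "\<epsilon> > 0"
      from frequently_eventually_frequently[OF small[OF this] eventually_le_at_bot[of t]]
      obtain s where s: "exp (- P s) * y s < \<epsilon>" "s \<le> t" by (auto dest: frequently_ex)
      have "Z t \<le> Z s" using s by (intro mono)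
      also have "\<dots> \<le> exp (- P s) * y s" unfolding Z_def using c G' k by simp
      finally show "Z t \<le> 0 + \<epsilon>" using s by simp
    qed
    then have "y t \<le> exp (P t) * (c * G' / k * exp (k * t))"
      by (simp add: Z_def exp_minus field_simps)
    also have "\<dots> = c * (G' / k) * exp (P t + k * t)" by (simp add: exp_add)
    also have "\<dots> \<le> c * (G' / k) * exp (K + 4 * \<delta> * \<bar>T\<bar> + e * \<bar>t\<bar>)"
    proof -
      have "2 * \<delta> * (- t) \<le> 2 * \<delta> * \<bar>t\<bar>" using \<delta>(1) by (intro mult_left_mono) auto
      moreover have "3 * \<delta> * \<bar>t\<bar> \<le> e * \<bar>t\<bar>" using \<delta>(2) by (intro mult_right_mono) auto
      moreover have "P t + \<mu> * t \<le> K + \<delta> * \<bar>t\<bar>" using K[OF t] by linarith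
      moreover have "0 \<le> 4 * \<delta> * \<bar>T\<bar>" using \<delta>(1) by simp
      ultimately have "P t + k * t \<le> K + 4 * \<delta> * \<bar>T\<bar> + e * \<bar>t\<bar>" by (simp add: k_def algebra_simps)
      then show ?thesis using c G' k by (intro mult_left_mono) auto
    qed
    also have "\<dots> = c * C * exp (e * \<bar>t\<bar>)" by (simp add: C_def exp_add)
    finally show ?thesis .
  qed
  moreover have "C \<ge> 0" using G' k by (simp add: C_def)
  ultimately show ?thesis by blast
qed

text \<open>This provides the smallness hypothesis of \<open>pullback_comparison\<close> for functions whose
  growth is already known to be subexponential.\<close>

lemma weighted_subexp_past_vanishes:
  fixes P y :: "real \<Rightarrow> real"
  assumes P: "continuous_on UNIV P" "((\<lambda>t. P t / t) \<longlongrightarrow> - \<mu>) at_bot" "\<mu> > 0"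
    and y: "subexp_past y" "\<And>t. 0 \<le> y t"
  shows "((\<lambda>t. exp (- P t) * y t) \<longlongrightarrow> 0) at_bot"
proof -
  obtain K where K: "\<And>t. t \<le> 0 \<Longrightarrow> \<bar>P t + \<mu> * t\<bar> \<le> K + \<mu> / 4 * \<bar>t\<bar>"
    using exponent_close_to_linear[OF P(1,2), of "\<mu> / 4" 0] P(3) by auto
  obtain C where C: "C \<ge> 0" "\<And>t. t \<le> 0 \<Longrightarrow> y t \<le> C * exp (\<mu> / 4 * \<bar>t\<bar>)"
    using y(1) P(3) by (metis subexp_pastE zero_less_divide_iff zero_less_numeral)
  have "exp (- P t) * y t \<le> C * exp K * exp (\<mu> / 2 * t)" if t: "t \<le> 0" for t
  proof -
    have "exp (- P t) * y t \<le> exp (- P t) * (C * exp (\<mu> / 4 * \<bar>t\<bar>))" using C(2)[OF t] by simp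
    also have "\<dots> = C * exp (\<mu> / 4 * \<bar>t\<bar> - P t)" by (simp add: exp_add[symmetric])
    also have "\<dots> \<le> C * exp (K + \<mu> / 2 * t)"
      using K[OF t] t C(1) by (intro mult_left_mono) auto
    finally show ?thesis by (simp add: exp_add)
  qed
  then have ev: "eventually (\<lambda>t. exp (- P t) * y t \<le> C * exp K * exp (\<mu> / 2 * t)) at_bot"
    using eventually_le_at_bot[of 0] by (rule eventually_mono[rotated])
  have "((\<lambda>t. exp (\<mu> / 2 * t)) \<longlongrightarrow> 0) at_bot" using P(3) by real_asymp
  then have lim: "((\<lambda>t. C * exp K * exp (\<mu> / 2 * t)) \<longlongrightarrow> 0) at_bot" by (rule tendsto_mult_right_zero)
  show ?thesis
    by (rule tendsto_sandwich[OF _ ev tendsto_const lim]) (simp add: y(2))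
qed

lemma past_average_antiderivative:
  fixes z :: "real \<Rightarrow> real"
  assumes z: "continuous_on UNIV z" "((\<lambda>T. integral {-T..0} z / T) \<longlongrightarrow> m) at_top"
  obtains A where "\<And>t. (A has_real_derivative z t) (at t)" "((\<lambda>t. A t / t) \<longlongrightarrow> m) at_bot"
proof
  define A where "A t = integral {0..t} z - integral {t..0} z" for t
  show "(A has_real_derivative z t) (at t)" for t
    unfolding A_def[abs_def] by (rule antiderivative_on_reals[OF z(1)])
  have "((\<lambda>t. integral {-(-t)..0} z / (-t)) \<longlongrightarrow> m) at_bot"
    by (rule filterlim_compose[OF z(2) filterlim_uminus_at_top_at_bot])
  moreover have "eventually (\<lambda>t. integral {-(-t)..0} z / (-t) = A t / t) at_bot"
    using eventually_gt_at_bot[of 0] by eventually_elim (simp add: A_def)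
  ultimately show "((\<lambda>t. A t / t) \<longlongrightarrow> m) at_bot" by (simp add: tendsto_cong)
qed


section \<open>Dissipativity of the transformed drift and of the coupling\<close>

definition noisy_drift :: "('x::euclidean_space \<Rightarrow> 'x) \<Rightarrow> real \<Rightarrow> 'x \<Rightarrow> real \<Rightarrow> 'x \<Rightarrow> 'x" where
  "noisy_drift h a b z u = transformed_drift h a b z u + z *\<^sub>R (a *\<^sub>R u + b)"

text \<open>With \<open>E = e\<^bsup>a z\<^esup>\<close>, the arguments of \<open>h\<close> differ by \<open>E (u - w)\<close>. The inner product produces
  one factor \<open>1 / E\<close> from the outer conjugation and one from replacing \<open>u - w\<close> by the difference
  of the arguments; both cancel against \<open>E\<^sup>2\<close> from the squared norm.\<close>

lemma noisy_drift_dissipative: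
  assumes h: "\<And>x y. (x - y) \<bullet> (h x - h y) \<le> - L * (norm (x - y))\<^sup>2"
  shows "(u - w) \<bullet> (noisy_drift h a b z u - noisy_drift h a b z w) \<le> (- L + a * z) * (norm (u - w))\<^sup>2"
proof -
  define E where "E = exp (a * z)"
  define X Y where "X = E *\<^sub>R u + ((E - 1) / a) *\<^sub>R b" and "Y = E *\<^sub>R w + ((E - 1) / a) *\<^sub>R b"
  have E: "E > 0" "exp (- a * z) = inverse E" by (auto simp: E_def exp_minus)
  have XY: "X - Y = E *\<^sub>R (u - w)" by (simp add: X_def Y_def scaleR_diff_right)
  have "(u - w) \<bullet> (noisy_drift h a b z u - noisy_drift h a b z w) =
      inverse E * ((u - w) \<bullet> (h X - h Y)) + a * z * (norm (u - w))\<^sup>2"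
    unfolding noisy_drift_def transformed_drift_def E(2) X_def[unfolded E_def, symmetric]
      Y_def[unfolded E_def, symmetric]
    by (simp add: power2_norm_eq_inner inner_diff_right inner_add_right algebra_simps)
  also have "(u - w) \<bullet> (h X - h Y) = inverse E * ((X - Y) \<bullet> (h X - h Y))"
    using E by (simp add: XY)
  also have "inverse E * (inverse E * ((X - Y) \<bullet> (h X - h Y))) \<le>
      inverse E * (inverse E * (- L * (norm (X - Y))\<^sup>2))"
    using E by (intro mult_left_mono h) auto
  also have "\<dots> = - L * (norm (u - w))\<^sup>2"
  proof -
    have "inverse E * (inverse E * (- L * (E\<^sup>2 * N))) = - L * N" for N
      using E(1) by (simp add: power2_eq_square field_simps)
    moreover have "(norm (X - Y))\<^sup>2 = E\<^sup>2 * (norm (u - w))\<^sup>2"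
      using E(1) by (simp add: XY power_mult_distrib)
    ultimately show ?thesis by (simp only:)
  qed
  finally show ?thesis by (simp add: algebra_simps)
qed

text \<open>In front of the linear part of the growth bound the two exponentials cancel. What remains
  of them is controlled by \<open>e\<^bsup>|a| |z|\<^esup>\<close>, which is subexponential because \<open>z\<close> is sublinear.\<close>

lemma noisy_drift_growth:
  fixes h :: "'x::euclidean_space \<Rightarrow> 'x" and z :: "real \<Rightarrow> real"
  assumes h: "linear_growth h" and a: "a \<noteq> 0"
    and z: "continuous_on UNIV z" "((\<lambda>t. z t / t) \<longlongrightarrow> 0) at_infinity"
  shows "\<exists>c. subexp_past c \<and> (\<forall>t. 0 \<le> c t) \<and> (\<forall>t w. norm (noisy_drift h a b (z t) w) \<le> c t * (norm w + 1))"
proof -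
  obtain l m where l: "l > 0" "m > 0" "\<And>x. norm (h x) \<le> l * norm x + m"
    using h unfolding linear_growth_def by blast
  define E Z where "E t = exp (\<bar>a\<bar> * \<bar>z t\<bar>)" and "Z t = exp (1 * \<bar>z t\<bar>)" for t
  define k where "k = l * norm b / \<bar>a\<bar>"
  have k: "k \<ge> 0" using l by (simp add: k_def)
  define c where "c t = (l + k) + (k + m) * E t + (\<bar>a\<bar> + norm b) * Z t" for t
  have EZ: "subexp_past E" "subexp_past Z"
    unfolding E_def[abs_def] Z_def[abs_def] by (rule subexp_past_exp_sublinear[OF z])+
  then have "subexp_past c"
    unfolding c_def[abs_def] using l k
    by (intro subexp_past_add subexp_past_const subexp_past_mult EZ) (auto simp: E_def Z_def)
  moreover have "0 \<le> c t" for t using l k by (simp add: c_def E_def Z_def)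
  moreover have "norm (noisy_drift h a b (z t) w) \<le> c t * (norm w + 1)" for t w
  proof -
    have e1: "exp (- a * z t) \<le> E t" using abs_ge_self[of "- (a * z t)"] by (simp add: E_def abs_mult)
    have e2: "exp (- a * z t) * \<bar>exp (a * z t) - 1\<bar> \<le> 1 + E t"
    proof -
      have "exp (- a * z t) * \<bar>exp (a * z t) - 1\<bar> \<le> exp (- a * z t) * (exp (a * z t) + 1)"
        by (intro mult_left_mono) (auto simp: abs_le_iff intro: order_trans)
      also have "\<dots> = 1 + exp (- a * z t)" by (simp add: distrib_left exp_minus)
      finally show ?thesis using e1 by simp
    qed
    have e3: "\<bar>z t\<bar> \<le> Z t" using exp_ge_add_one_self[of "\<bar>z t\<bar>"] unfolding Z_def mult_1 by linarith
    define X where "X = exp (a * z t) *\<^sub>R w + ((exp (a * z t) - 1) / a) *\<^sub>R b"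
    have X: "norm X \<le> exp (a * z t) * norm w + \<bar>exp (a * z t) - 1\<bar> / \<bar>a\<bar> * norm b"
      unfolding X_def by (rule order_trans[OF norm_triangle_ineq]) simp
    have "norm (noisy_drift h a b (z t) w) \<le>
        exp (- a * z t) * norm (h X) + \<bar>z t\<bar> * norm (a *\<^sub>R w + b)"
      unfolding noisy_drift_def transformed_drift_def X_def[symmetric]
      by (rule order_trans[OF norm_triangle_ineq]) simp
    also have "\<dots> \<le> exp (- a * z t) * (l * (exp (a * z t) * norm w + \<bar>exp (a * z t) - 1\<bar> / \<bar>a\<bar> * norm b) + m)
        + Z t * (\<bar>a\<bar> * norm w + norm b)"
    proof (intro add_mono mult_mono e3)
      show "norm (h X) \<le> l * (exp (a * z t) * norm w + \<bar>exp (a * z t) - 1\<bar> / \<bar>a\<bar> * norm b) + m"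
        using l(3)[of X] mult_left_mono[OF X, of l] l(1) by linarith
      show "norm (a *\<^sub>R w + b) \<le> \<bar>a\<bar> * norm w + norm b"
        by (rule order_trans[OF norm_triangle_ineq]) simp
    qed (use k l in \<open>auto simp: Z_def\<close>)
    also have "\<dots> = l * norm w + k * (exp (- a * z t) * \<bar>exp (a * z t) - 1\<bar>) + m * exp (- a * z t)
        + Z t * (\<bar>a\<bar> * norm w + norm b)"
    proof -
      have "e * (l * (E * n + q / \<bar>a\<bar> * norm b) + m) = (e * E) * (l * n) + k * (e * q) + m * e" for e E n q
        by (simp add: k_def algebra_simps)
      moreover have "exp (- a * z t) * exp (a * z t) = 1" by (simp add: exp_minus)
      ultimately show ?thesis by (simp only: mult_1)
    qed
    also have "\<dots> \<le> l * norm w + k * (1 + E t) + m * E t + Z t * (\<bar>a\<bar> * norm w + norm b)"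
      using k l by (intro add_mono mult_left_mono e1 e2) (auto simp: Z_def)
    also have "\<dots> \<le> c t * (norm w + 1)"
    proof -
      have "0 \<le> k * norm w" "0 \<le> (k + m) * E t * norm w" "0 \<le> norm b * Z t * norm w" "0 \<le> \<bar>a\<bar> * Z t"
        using k l by (auto simp: E_def Z_def)
      moreover have "c t * (norm w + 1) = l * norm w + k * (1 + E t) + m * E t + Z t * (\<bar>a\<bar> * norm w + norm b)
          + (l + k * norm w + (k + m) * E t * norm w + norm b * Z t * norm w + \<bar>a\<bar> * Z t)"
        by (simp add: c_def algebra_simps)
      ultimately show ?thesis using l(1) by linarith
    qed
    finally show ?thesis .
  qed
  ultimately show ?thesis by blast
qed

text \<open>The rates of the two components differ, and the larger of \<open>\<alpha>\<close> and \<open>\<beta>\<close> would in general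
  have a positive time average. The coupling repairs this: the excess over the mean rate is
  \<open>(\<alpha> - \<beta>) (|x|\<^sup>2 - |y|\<^sup>2) = (\<alpha> - \<beta>) ((x - y) \<bullet> (x + y))\<close>, which contains the damped
  difference \<open>x - y\<close>. Of the dissipation \<open>2 \<kappa> |x - y|\<^sup>2\<close>, one half absorbs this excess at the
  price of \<open>(\<alpha>\<^sup>2 + \<beta>\<^sup>2) / \<kappa>\<close> in the rate, and the other half absorbs the residual \<open>h\<close>.\<close>

lemma coupling_dissipation:
  fixes x y h p q :: "'x::euclidean_space"
  assumes \<kappa>: "\<kappa> > 0"
    and p: "x \<bullet> p \<le> (- L + \<alpha>) * (norm x)\<^sup>2" and q: "y \<bullet> q \<le> (- L + \<beta>) * (norm y)\<^sup>2"
  shows "2 * (x \<bullet> (p - h + \<kappa> *\<^sub>R (y - x))) + 2 * (y \<bullet> (q + h + \<kappa> *\<^sub>R (x - y))) \<le>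
    (- 2 * L + \<alpha> + \<beta> + (\<alpha>\<^sup>2 + \<beta>\<^sup>2) / \<kappa>) * ((norm x)\<^sup>2 + (norm y)\<^sup>2) + (norm h)\<^sup>2 / \<kappa>"
proof -
  define X Y D S N where "X = (norm x)\<^sup>2" and "Y = (norm y)\<^sup>2" and "D = (norm (x - y))\<^sup>2"
    and "S = (norm (x + y))\<^sup>2" and "N = (norm h)\<^sup>2"
  note defs = X_def Y_def D_def S_def N_def
  have "2 * (x \<bullet> (p - h + \<kappa> *\<^sub>R (y - x))) + 2 * (y \<bullet> (q + h + \<kappa> *\<^sub>R (x - y))) =
      2 * (x \<bullet> p) + 2 * (y \<bullet> q) - 2 * (h \<bullet> (x - y)) - 2 * \<kappa> * D"
    by (simp add: defs power2_norm_eq_inner inner_commute algebra_simps)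
  moreover have "- 2 * (h \<bullet> (x - y)) \<le> N / \<kappa> + \<kappa> * D"
  proof -
    have "0 \<le> (norm (h + \<kappa> *\<^sub>R (x - y)))\<^sup>2" by simp
    also have "\<dots> = N + 2 * \<kappa> * (h \<bullet> (x - y)) + \<kappa> * (\<kappa> * D)"
      by (simp add: defs power2_norm_eq_inner inner_commute algebra_simps)
    finally show ?thesis using \<kappa> by (simp add: field_simps)
  qed
  moreover have "(\<alpha> - \<beta>) * (X - Y) \<le> \<kappa> * D + (\<alpha> - \<beta>)\<^sup>2 * S / (4 * \<kappa>)"
  proof -
    have "0 \<le> (norm ((\<alpha> - \<beta>) *\<^sub>R (x + y) - (2 * \<kappa>) *\<^sub>R (x - y)))\<^sup>2" by simp
    also have "\<dots> = (\<alpha> - \<beta>)\<^sup>2 * S - 4 * \<kappa> * ((\<alpha> - \<beta>) * (X - Y)) + 4 * \<kappa> * (\<kappa> * D)"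
      unfolding defs power2_norm_eq_inner power2_eq_square[of "\<alpha> - \<beta>"]
      by (simp add: inner_commute inner_diff_left inner_diff_right inner_add_left inner_add_right algebra_simps)
    finally show ?thesis using \<kappa> by (simp add: field_simps)
  qed
  moreover have "(\<alpha> - \<beta>)\<^sup>2 * S / (4 * \<kappa>) \<le> (\<alpha>\<^sup>2 + \<beta>\<^sup>2) / \<kappa> * (X + Y)"
  proof -
    have "S + D = 2 * (X + Y)" by (simp add: defs power2_norm_eq_inner inner_commute algebra_simps)
    moreover have "0 \<le> D" by (simp add: D_def)
    ultimately have S: "S \<le> 2 * (X + Y)" by linarith
    have "0 \<le> (\<alpha> + \<beta>)\<^sup>2" by simp
    then have "(\<alpha> - \<beta>)\<^sup>2 \<le> 2 * (\<alpha>\<^sup>2 + \<beta>\<^sup>2)" by (simp add: power2_eq_square algebra_simps)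
    then have "(\<alpha> - \<beta>)\<^sup>2 * S \<le> 2 * (\<alpha>\<^sup>2 + \<beta>\<^sup>2) * (2 * (X + Y))"
      using S by (intro mult_mono) (auto simp: S_def)
    then show ?thesis using \<kappa> by (simp add: field_simps)
  qed
  moreover have "2 * (x \<bullet> p) + 2 * (y \<bullet> q) \<le> (- 2 * L + \<alpha> + \<beta>) * (X + Y) + (\<alpha> - \<beta>) * (X - Y)"
    using p q unfolding X_def[symmetric] Y_def[symmetric] by (simp add: algebra_simps)
  ultimately have "2 * (x \<bullet> (p - h + \<kappa> *\<^sub>R (y - x))) + 2 * (y \<bullet> (q + h + \<kappa> *\<^sub>R (x - y))) \<le>
      (- 2 * L + \<alpha> + \<beta>) * (X + Y) + (\<alpha>\<^sup>2 + \<beta>\<^sup>2) / \<kappa> * (X + Y) + N / \<kappa>"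
    by linarith
  then show ?thesis unfolding X_def Y_def N_def by (simp only: distrib_right)
qed

lemma has_real_derivative_norm_squared:
  fixes u :: "real \<Rightarrow> 'x::euclidean_space"
  assumes "(u has_vector_derivative u') (at t)"
  shows "((\<lambda>t. (norm (u t))\<^sup>2) has_real_derivative 2 * (u t \<bullet> u')) (at t)"
proof -
  have "((\<lambda>t. u t \<bullet> u t) has_derivative (\<lambda>s. u t \<bullet> (s *\<^sub>R u') + (s *\<^sub>R u') \<bullet> u t)) (at t)"
    using assms unfolding has_vector_derivative_def by (intro has_derivative_inner)
  moreover have "(\<lambda>s. u t \<bullet> (s *\<^sub>R u') + (s *\<^sub>R u') \<bullet> u t) = (*) (2 * (u t \<bullet> u'))"
    by (auto simp: inner_commute)
  ultimately show ?thesis by (simp add: has_field_derivative_def power2_norm_eq_inner)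
qed


section \<open>Synchronization along a single path\<close>

text \<open>The pathwise properties of an Ornstein--Uhlenbeck path that govern growth and decay in the
  remote past; \<open>v\<close> is the past time average of its square.\<close>

definition ou_like :: "(real \<Rightarrow> real) \<Rightarrow> real \<Rightarrow> bool" where
  "ou_like z v \<longleftrightarrow> continuous_on UNIV z \<and> ((\<lambda>t. z t / t) \<longlongrightarrow> 0) at_infinity \<and>
     ((\<lambda>T. integral {-T..0} z / T) \<longlongrightarrow> 0) at_top \<and>
     ((\<lambda>T. integral {-T..0} (\<lambda>s. (z s)\<^sup>2) / T) \<longlongrightarrow> v) at_top"

text \<open>The average growth rate in the past sees the noise only through \<open>v\<^sub>1\<close> and \<open>v\<^sub>2\<close>, because
  the first moments average to zero. The quadratic weight \<open>d\<close> is \<open>0\<close> for the averaged equation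
  and an inverse coupling strength for the synchronization error.\<close>

lemma exponent_of_ou_like:
  assumes z\<^sub>1: "ou_like z\<^sub>1 v\<^sub>1" and z\<^sub>2: "ou_like z\<^sub>2 v\<^sub>2"
  obtains P where
    "\<And>t. (P has_real_derivative - \<rho> + a\<^sub>1 * z\<^sub>1 t + a\<^sub>2 * z\<^sub>2 t + d * ((a\<^sub>1 * z\<^sub>1 t)\<^sup>2 + (a\<^sub>2 * z\<^sub>2 t)\<^sup>2)) (at t)"
    "((\<lambda>t. P t / t) \<longlongrightarrow> - (\<rho> - d * (a\<^sub>1\<^sup>2 * v\<^sub>1 + a\<^sub>2\<^sup>2 * v\<^sub>2))) at_bot"
proof -
  have sq: "continuous_on UNIV (\<lambda>s. (z s)\<^sup>2)" if "ou_like z v" for z v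
    using that by (intro continuous_intros) (simp add: ou_like_def)
  obtain A\<^sub>1 where A\<^sub>1: "\<And>t. (A\<^sub>1 has_real_derivative z\<^sub>1 t) (at t)" "((\<lambda>t. A\<^sub>1 t / t) \<longlongrightarrow> 0) at_bot"
    using past_average_antiderivative[of z\<^sub>1 0] z\<^sub>1 unfolding ou_like_def by blast
  obtain A\<^sub>2 where A\<^sub>2: "\<And>t. (A\<^sub>2 has_real_derivative z\<^sub>2 t) (at t)" "((\<lambda>t. A\<^sub>2 t / t) \<longlongrightarrow> 0) at_bot"
    using past_average_antiderivative[of z\<^sub>2 0] z\<^sub>2 unfolding ou_like_def by blast
  obtain S\<^sub>1 where S\<^sub>1: "\<And>t. (S\<^sub>1 has_real_derivative (z\<^sub>1 t)\<^sup>2) (at t)" "((\<lambda>t. S\<^sub>1 t / t) \<longlongrightarrow> v\<^sub>1) at_bot"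
    using past_average_antiderivative[OF sq[OF z\<^sub>1], of v\<^sub>1] z\<^sub>1 unfolding ou_like_def by blast
  obtain S\<^sub>2 where S\<^sub>2: "\<And>t. (S\<^sub>2 has_real_derivative (z\<^sub>2 t)\<^sup>2) (at t)" "((\<lambda>t. S\<^sub>2 t / t) \<longlongrightarrow> v\<^sub>2) at_bot"
    using past_average_antiderivative[OF sq[OF z\<^sub>2], of v\<^sub>2] z\<^sub>2 unfolding ou_like_def by blast
  define P where "P t = - \<rho> * t + a\<^sub>1 * A\<^sub>1 t + a\<^sub>2 * A\<^sub>2 t + d * (a\<^sub>1\<^sup>2 * S\<^sub>1 t + a\<^sub>2\<^sup>2 * S\<^sub>2 t)" for t
  show thesis
  proof (rule that)
    show "(P has_real_derivative - \<rho> + a\<^sub>1 * z\<^sub>1 t + a\<^sub>2 * z\<^sub>2 t + d * ((a\<^sub>1 * z\<^sub>1 t)\<^sup>2 + (a\<^sub>2 * z\<^sub>2 t)\<^sup>2)) (at t)" for t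
      unfolding P_def[abs_def]
      by (auto intro!: derivative_eq_intros A\<^sub>1(1) A\<^sub>2(1) S\<^sub>1(1) S\<^sub>2(1) simp: power_mult_distrib)
    have "((\<lambda>t. - \<rho> + a\<^sub>1 * (A\<^sub>1 t / t) + a\<^sub>2 * (A\<^sub>2 t / t) + d * (a\<^sub>1\<^sup>2 * (S\<^sub>1 t / t) + a\<^sub>2\<^sup>2 * (S\<^sub>2 t / t)))
        \<longlongrightarrow> - \<rho> + a\<^sub>1 * 0 + a\<^sub>2 * 0 + d * (a\<^sub>1\<^sup>2 * v\<^sub>1 + a\<^sub>2\<^sup>2 * v\<^sub>2)) at_bot"
      by (intro tendsto_intros A\<^sub>1 A\<^sub>2 S\<^sub>1 S\<^sub>2)
    moreover have "eventually (\<lambda>t. - \<rho> + a\<^sub>1 * (A\<^sub>1 t / t) + a\<^sub>2 * (A\<^sub>2 t / t)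
        + d * (a\<^sub>1\<^sup>2 * (S\<^sub>1 t / t) + a\<^sub>2\<^sup>2 * (S\<^sub>2 t / t)) = P t / t) at_bot"
      using eventually_gt_at_bot[of 0]
      by eventually_elim (simp add: P_def add_divide_distrib diff_divide_distrib distrib_left)
    ultimately show "((\<lambda>t. P t / t) \<longlongrightarrow> - (\<rho> - d * (a\<^sub>1\<^sup>2 * v\<^sub>1 + a\<^sub>2\<^sup>2 * v\<^sub>2))) at_bot"
      by (simp add: tendsto_cong)
  qed
qed

text \<open>Solutions are taken on all of \<open>\<real>\<close>, since a comparison started at \<open>- \<infinity>\<close> needs them at
  arbitrarily early times.\<close>

definition averaged_solution ::
  "(real \<Rightarrow> 'x::euclidean_space \<Rightarrow> 'x) \<Rightarrow> (real \<Rightarrow> 'x \<Rightarrow> 'x) \<Rightarrow> (real \<Rightarrow> 'x) \<Rightarrow> bool" where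
  "averaged_solution F\<^sub>1 F\<^sub>2 w \<longleftrightarrow>
     (\<forall>t. (w has_vector_derivative (1 / 2) *\<^sub>R (F\<^sub>1 t (w t) + F\<^sub>2 t (w t))) (at t))"

definition coupled_solution ::
  "(real \<Rightarrow> 'x::euclidean_space \<Rightarrow> 'x) \<Rightarrow> (real \<Rightarrow> 'x \<Rightarrow> 'x) \<Rightarrow> real \<Rightarrow>
   (real \<Rightarrow> 'x) \<Rightarrow> (real \<Rightarrow> 'x) \<Rightarrow> bool" where
  "coupled_solution F\<^sub>1 F\<^sub>2 \<kappa> u v \<longleftrightarrow>
     (\<forall>t. (u has_vector_derivative F\<^sub>1 t (u t) + \<kappa> *\<^sub>R (v t - u t)) (at t) \<and>
          (v has_vector_derivative F\<^sub>2 t (v t) + \<kappa> *\<^sub>R (u t - v t)) (at t))"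

text \<open>The deterministic data that remain of the random equations once a noise path is fixed.\<close>

locale dissipative_pair =
  fixes F\<^sub>1 F\<^sub>2 :: "real \<Rightarrow> 'x::euclidean_space \<Rightarrow> 'x"
    and z\<^sub>1 z\<^sub>2 :: "real \<Rightarrow> real" and a\<^sub>1 a\<^sub>2 v\<^sub>1 v\<^sub>2 L :: real
  assumes L: "L > 0" and ou: "ou_like z\<^sub>1 v\<^sub>1" "ou_like z\<^sub>2 v\<^sub>2"
    and dissipative:
      "(u - w) \<bullet> (F\<^sub>1 t u - F\<^sub>1 t w) \<le> (- L + a\<^sub>1 * z\<^sub>1 t) * (norm (u - w))\<^sup>2"
      "(u - w) \<bullet> (F\<^sub>2 t u - F\<^sub>2 t w) \<le> (- L + a\<^sub>2 * z\<^sub>2 t) * (norm (u - w))\<^sup>2"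
    and growth:
      "\<exists>c. subexp_past c \<and> (\<forall>t. 0 \<le> c t) \<and> (\<forall>t w. norm (F\<^sub>1 t w) \<le> c t * (norm w + 1))"
      "\<exists>c. subexp_past c \<and> (\<forall>t. 0 \<le> c t) \<and> (\<forall>t w. norm (F\<^sub>2 t w) \<le> c t * (norm w + 1))"
begin

lemma joint_growth:
  obtains c where "subexp_past c" "\<And>t. 0 \<le> c t"
    "\<And>t w. norm (F\<^sub>1 t w) + norm (F\<^sub>2 t w) \<le> c t * (norm w + 1)"
proof -
  obtain c where c: "subexp_past c" "\<And>t. 0 \<le> c t" "\<And>t w. norm (F\<^sub>1 t w) \<le> c t * (norm w + 1)"
    using growth(1) by blast
  obtain d where d: "subexp_past d" "\<And>t. 0 \<le> d t" "\<And>t w. norm (F\<^sub>2 t w) \<le> d t * (norm w + 1)"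
    using growth(2) by blast
  show thesis
  proof (rule that)
    show "subexp_past (\<lambda>t. c t + d t)" using c(1) d(1) by (rule subexp_past_add)
    show "0 \<le> c t + d t" for t using c(2) d(2) by simp
    show "norm (F\<^sub>1 t w) + norm (F\<^sub>2 t w) \<le> (c t + d t) * (norm w + 1)" for t w
      using add_mono[OF c(3) d(3)] by (simp only: distrib_right[of "c t" "d t"])
  qed
qed

text \<open>Dissipativity compares \<open>F\<^sub>i(t, w)\<close> with \<open>F\<^sub>i(t, 0)\<close> and yields
  \<open>(|w|\<^sup>2)' \<le> (- L + \<alpha> + \<beta>) |w|\<^sup>2 + \<gamma>\<close>, where half of the rate \<open>2 L\<close> is spent on absorbing the
  inhomogeneity \<open>F\<^sub>1(t, 0) + F\<^sub>2(t, 0)\<close>. Bounds at arbitrarily early times are enough to start the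
  comparison, and its conclusion holds at all times.\<close>

lemma averaged_solution_subexp_past:
  assumes w: "averaged_solution F\<^sub>1 F\<^sub>2 w" and recur: "\<exists>\<^sub>F t in at_bot. norm (w t) \<le> K"
  shows "subexp_past (\<lambda>t. norm (w t))"
proof -
  obtain c where c: "subexp_past c" "\<And>t. 0 \<le> c t"
    "\<And>t w. norm (F\<^sub>1 t w) + norm (F\<^sub>2 t w) \<le> c t * (norm w + 1)"
    by (rule joint_growth) blast
  define \<gamma> where "\<gamma> t = 1 / (4 * L) * (c t * c t)" for t
  have \<gamma>: "subexp_past \<gamma>"
    unfolding \<gamma>_def[abs_def] using L c by (intro subexp_past_mult subexp_past_const) auto
  obtain P where P: "\<And>t. (P has_real_derivative - L + a\<^sub>1 * z\<^sub>1 t + a\<^sub>2 * z\<^sub>2 t) (at t)"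
    "((\<lambda>t. P t / t) \<longlongrightarrow> - L) at_bot"
    using exponent_of_ou_like[OF ou, of L a\<^sub>1 a\<^sub>2 0] by auto
  have contP: "continuous_on UNIV P" using P(1) by (meson DERIV_isCont continuous_at_imp_continuous_on)
  define y where "y t = (norm (w t))\<^sup>2" for t
  have dy: "\<exists>D. (y has_real_derivative D) (at t) \<and> D \<le> (- L + a\<^sub>1 * z\<^sub>1 t + a\<^sub>2 * z\<^sub>2 t) * y t + 1 * \<gamma> t" for t
  proof (intro exI conjI)
    define G where "G = F\<^sub>1 t 0 + F\<^sub>2 t 0"
    show "(y has_real_derivative 2 * (w t \<bullet> ((1 / 2) *\<^sub>R (F\<^sub>1 t (w t) + F\<^sub>2 t (w t))))) (at t)"
      unfolding y_def using w by (intro has_real_derivative_norm_squared) (auto simp: averaged_solution_def)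
    have "w t \<bullet> (F\<^sub>1 t (w t) - F\<^sub>1 t 0) \<le> (- L + a\<^sub>1 * z\<^sub>1 t) * y t"
      "w t \<bullet> (F\<^sub>2 t (w t) - F\<^sub>2 t 0) \<le> (- L + a\<^sub>2 * z\<^sub>2 t) * y t"
      using dissipative(1)[of "w t" 0 t] dissipative(2)[of "w t" 0 t] by (simp_all add: y_def)
    moreover have "w t \<bullet> G \<le> L * y t + \<gamma> t"
    proof -
      have "norm G \<le> c t" unfolding G_def using c(3)[of t 0] norm_triangle_ineq[of "F\<^sub>1 t 0" "F\<^sub>2 t 0"] by simp
      then have "norm G * norm G \<le> c t * c t" by (intro mult_mono c(2)) auto
      then have "1 / (4 * L) * (norm G * norm G) \<le> \<gamma> t" unfolding \<gamma>_def using L by (intro mult_left_mono) auto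
      moreover have "w t \<bullet> G \<le> L * y t + 1 / (4 * L) * (norm G * norm G)"
      proof -
        have "0 \<le> (norm (G - (2 * L) *\<^sub>R w t))\<^sup>2" by simp
        also have "\<dots> = norm G * norm G - 4 * L * (w t \<bullet> G) + 4 * L * (L * y t)"
          unfolding power2_eq_square[of "norm G", symmetric] y_def power2_norm_eq_inner
          by (simp add: inner_commute algebra_simps)
        finally show ?thesis using L by (simp add: field_simps)
      qed
      ultimately show ?thesis by linarith
    qed
    moreover have "2 * (w t \<bullet> ((1 / 2) *\<^sub>R (F\<^sub>1 t (w t) + F\<^sub>2 t (w t)))) =
       w t \<bullet> (F\<^sub>1 t (w t) - F\<^sub>1 t 0) + w t \<bullet> (F\<^sub>2 t (w t) - F\<^sub>2 t 0) + w t \<bullet> G"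
      by (simp add: G_def algebra_simps)
    ultimately show "2 * (w t \<bullet> ((1 / 2) *\<^sub>R (F\<^sub>1 t (w t) + F\<^sub>2 t (w t)))) \<le>
        (- L + a\<^sub>1 * z\<^sub>1 t + a\<^sub>2 * z\<^sub>2 t) * y t + 1 * \<gamma> t"
      by (simp add: algebra_simps)
  qed
  have small: "\<exists>\<^sub>F t in at_bot. exp (- P t) * y t < \<epsilon>" if "\<epsilon> > 0" for \<epsilon>
  proof -
    have "((\<lambda>t. exp (- P t) * K\<^sup>2) \<longlongrightarrow> 0) at_bot"
      by (rule weighted_subexp_past_vanishes[OF contP P(2) L subexp_past_const]) simp
    then have "eventually (\<lambda>t. exp (- P t) * K\<^sup>2 < \<epsilon>) at_bot" using that by (rule order_tendstoD)
    then have "\<exists>\<^sub>F t in at_bot. norm (w t) \<le> K \<and> exp (- P t) * K\<^sup>2 < \<epsilon>"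
      using recur by (rule frequently_eventually_frequently[rotated])
    then show ?thesis
    proof (rule frequently_elim1)
      fix t assume t: "norm (w t) \<le> K \<and> exp (- P t) * K\<^sup>2 < \<epsilon>"
      then have "exp (- P t) * y t \<le> exp (- P t) * K\<^sup>2"
        unfolding y_def by (intro mult_left_mono power_mono) auto
      then show "exp (- P t) * y t < \<epsilon>" using t by linarith
    qed
  qed
  have "subexp_past y"
    unfolding subexp_past_def
  proof (intro allI impI)
    fix e T :: real assume "e > 0"
    from pullback_comparison[OF P L \<gamma> this, of T]
    obtain C where C: "C \<ge> 0" "\<forall>c y. 0 \<le> c \<longrightarrow>
      (\<forall>t. \<exists>D. (y has_real_derivative D) (at t) \<and> D \<le> (- L + a\<^sub>1 * z\<^sub>1 t + a\<^sub>2 * z\<^sub>2 t) * y t + c * \<gamma> t) \<longrightarrow>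
      (\<forall>\<epsilon>>0. \<exists>\<^sub>F t in at_bot. exp (- P t) * y t < \<epsilon>) \<longrightarrow> (\<forall>t\<le>T. y t \<le> c * C * exp (e * \<bar>t\<bar>))"
      by blast
    from C(2)[rule_format, of 1 y, OF _ dy small] C(1)
    show "\<exists>C\<ge>0. \<forall>t\<le>T. y t \<le> C * exp (e * \<bar>t\<bar>)" by auto
  qed
  then have "subexp_past (\<lambda>t. y t + 1)" by (intro subexp_past_add subexp_past_const)
  then show ?thesis
  proof (rule subexp_past_mono)
    show "norm (w t) \<le> y t + 1" for t
      using zero_le_power2[of "norm (w t) - 1"] norm_ge_zero[of "w t"]
      unfolding y_def power2_diff by (simp del: zero_le_power2 norm_ge_zero)
  qed
qed

text \<open>The error inequality holds for each \<open>\<kappa>\<close> with its own rate. Since the error is nonnegative,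
  all rates may be replaced by the one for the smallest admissible coupling strength \<open>\<kappa>\<^sub>0\<close>, so
  that a single weight \<open>P\<close>, and hence a single constant, serves every \<open>\<kappa> \<ge> \<kappa>\<^sub>0\<close>.\<close>

lemma synchronization_rate:
  assumes w: "averaged_solution F\<^sub>1 F\<^sub>2 w" "subexp_past (\<lambda>t. norm (w t))"
  shows "\<exists>C \<kappa>\<^sub>0. \<kappa>\<^sub>0 \<ge> 1 \<and> (\<forall>\<kappa>\<ge>\<kappa>\<^sub>0. \<forall>u v. coupled_solution F\<^sub>1 F\<^sub>2 \<kappa> u v \<longrightarrow>
      subexp_past (\<lambda>t. norm (u t)) \<longrightarrow> subexp_past (\<lambda>t. norm (v t)) \<longrightarrow>
      (\<forall>t\<le>T. (norm (u t - w t))\<^sup>2 + (norm (v t - w t))\<^sup>2 \<le> C / \<kappa> * exp \<bar>t\<bar>))"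
proof -
  obtain c where c: "subexp_past c" "\<And>t. 0 \<le> c t"
    "\<And>t w. norm (F\<^sub>1 t w) + norm (F\<^sub>2 t w) \<le> c t * (norm w + 1)"
    by (rule joint_growth) blast
  define \<gamma> where "\<gamma> t = (c t * (norm (w t) + 1)) * (c t * (norm (w t) + 1))" for t
  have \<gamma>: "subexp_past \<gamma>"
    unfolding \<gamma>_def[abs_def]
    by (intro subexp_past_mult subexp_past_add subexp_past_const c w mult_nonneg_nonneg add_nonneg_nonneg) auto
  define q where "q = a\<^sub>1\<^sup>2 * v\<^sub>1 + a\<^sub>2\<^sup>2 * v\<^sub>2"
  \<comment> \<open>\<open>q\<close> is the time average of \<open>(a\<^sub>1 z\<^sub>1)\<^sup>2 + (a\<^sub>2 z\<^sub>2)\<^sup>2\<close>; from \<open>\<kappa>\<^sub>0\<close> on, the quadratic part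
    of the rate uses up at most half of the dissipation \<open>2 L\<close>.\<close>
  define \<kappa>\<^sub>0 where "\<kappa>\<^sub>0 = max 1 (q / L)"
  define \<mu> where "\<mu> = 2 * L - 1 / \<kappa>\<^sub>0 * q"
  have \<kappa>\<^sub>0: "\<kappa>\<^sub>0 \<ge> 1" by (simp add: \<kappa>\<^sub>0_def)
  have "q \<le> L * \<kappa>\<^sub>0" using L by (simp add: \<kappa>\<^sub>0_def max_def field_simps)
  then have "1 / \<kappa>\<^sub>0 * q \<le> L" using \<kappa>\<^sub>0 by (simp add: divide_le_eq)
  then have \<mu>: "\<mu> > 0" using L unfolding \<mu>_def by linarith
  define r where "r t = - (2 * L) + a\<^sub>1 * z\<^sub>1 t + a\<^sub>2 * z\<^sub>2 t + 1 / \<kappa>\<^sub>0 * ((a\<^sub>1 * z\<^sub>1 t)\<^sup>2 + (a\<^sub>2 * z\<^sub>2 t)\<^sup>2)" for t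
  obtain P where P: "\<And>t. (P has_real_derivative r t) (at t)" "((\<lambda>t. P t / t) \<longlongrightarrow> - \<mu>) at_bot"
    using exponent_of_ou_like[OF ou, of "2 * L" a\<^sub>1 a\<^sub>2 "1 / \<kappa>\<^sub>0"] unfolding r_def \<mu>_def q_def by blast
  have contP: "continuous_on UNIV P" using P(1) by (meson DERIV_isCont continuous_at_imp_continuous_on)
  obtain C where C: "C \<ge> 0" "\<forall>c y. 0 \<le> c \<longrightarrow>
      (\<forall>t. \<exists>D. (y has_real_derivative D) (at t) \<and> D \<le> r t * y t + c * \<gamma> t) \<longrightarrow>
      (\<forall>\<epsilon>>0. \<exists>\<^sub>F t in at_bot. exp (- P t) * y t < \<epsilon>) \<longrightarrow> (\<forall>t\<le>T. y t \<le> c * C * exp (1 * \<bar>t\<bar>))"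
    using pullback_comparison[OF P \<mu> \<gamma> zero_less_one, of T] by blast
  have "(norm (u t - w t))\<^sup>2 + (norm (v t - w t))\<^sup>2 \<le> C / \<kappa> * exp \<bar>t\<bar>"
    if \<kappa>: "\<kappa> \<ge> \<kappa>\<^sub>0" and uv: "coupled_solution F\<^sub>1 F\<^sub>2 \<kappa> u v"
      and su: "subexp_past (\<lambda>t. norm (u t))" and sv: "subexp_past (\<lambda>t. norm (v t))" and t: "t \<le> T"
    for \<kappa> u v t
  proof -
    have kpos: "\<kappa> > 0" using \<kappa> \<kappa>\<^sub>0 by simp
    define y where "y t = (norm (u t - w t))\<^sup>2 + (norm (v t - w t))\<^sup>2" for t
    have y0: "0 \<le> y t" for t by (simp add: y_def)
    have dy: "\<exists>D. (y has_real_derivative D) (at t) \<and> D \<le> r t * y t + 1 / \<kappa> * \<gamma> t" for t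
    proof (intro exI conjI)
      define h where "h = (1 / 2) *\<^sub>R (F\<^sub>2 t (w t) - F\<^sub>1 t (w t))"
      let ?x = "u t - w t" and ?y = "v t - w t"
      define D where "D = 2 * (?x \<bullet> (F\<^sub>1 t (u t) - F\<^sub>1 t (w t) - h + \<kappa> *\<^sub>R (?y - ?x))) +
        2 * (?y \<bullet> (F\<^sub>2 t (v t) - F\<^sub>2 t (w t) + h + \<kappa> *\<^sub>R (?x - ?y)))"
      have half: "X = (1 / 2) *\<^sub>R X + (1 / 2) *\<^sub>R X" for X :: 'x
        by (simp add: scaleR_add_left[symmetric])
      have "((\<lambda>t. u t - w t) has_vector_derivative
          (F\<^sub>1 t (u t) + \<kappa> *\<^sub>R (v t - u t) - (1 / 2) *\<^sub>R (F\<^sub>1 t (w t) + F\<^sub>2 t (w t)))) (at t)"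
        "((\<lambda>t. v t - w t) has_vector_derivative
          (F\<^sub>2 t (v t) + \<kappa> *\<^sub>R (u t - v t) - (1 / 2) *\<^sub>R (F\<^sub>1 t (w t) + F\<^sub>2 t (w t)))) (at t)"
        using uv w(1) unfolding coupled_solution_def averaged_solution_def
        by (auto intro!: has_vector_derivative_diff)
      moreover have "F\<^sub>1 t (u t) + \<kappa> *\<^sub>R (v t - u t) - (1 / 2) *\<^sub>R (F\<^sub>1 t (w t) + F\<^sub>2 t (w t)) =
          F\<^sub>1 t (u t) - F\<^sub>1 t (w t) - h + \<kappa> *\<^sub>R (?y - ?x)"
        using half[of "F\<^sub>1 t (w t)"] by (simp add: h_def algebra_simps)
      moreover have "F\<^sub>2 t (v t) + \<kappa> *\<^sub>R (u t - v t) - (1 / 2) *\<^sub>R (F\<^sub>1 t (w t) + F\<^sub>2 t (w t)) =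
          F\<^sub>2 t (v t) - F\<^sub>2 t (w t) + h + \<kappa> *\<^sub>R (?x - ?y)"
        using half[of "F\<^sub>2 t (w t)"] by (simp add: h_def algebra_simps)
      ultimately show "(y has_real_derivative D) (at t)"
        unfolding y_def[abs_def] D_def by (intro DERIV_add has_real_derivative_norm_squared) auto
      have "D \<le> (- 2 * L + a\<^sub>1 * z\<^sub>1 t + a\<^sub>2 * z\<^sub>2 t + ((a\<^sub>1 * z\<^sub>1 t)\<^sup>2 + (a\<^sub>2 * z\<^sub>2 t)\<^sup>2) / \<kappa>) * y t + (norm h)\<^sup>2 / \<kappa>"
        unfolding D_def y_def by (rule coupling_dissipation[OF kpos dissipative])
      also have "\<dots> \<le> r t * y t + 1 / \<kappa> * \<gamma> t"
      proof (rule add_mono)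
        have "((a\<^sub>1 * z\<^sub>1 t)\<^sup>2 + (a\<^sub>2 * z\<^sub>2 t)\<^sup>2) / \<kappa> \<le> ((a\<^sub>1 * z\<^sub>1 t)\<^sup>2 + (a\<^sub>2 * z\<^sub>2 t)\<^sup>2) / \<kappa>\<^sub>0"
          using \<kappa> \<kappa>\<^sub>0 by (intro divide_left_mono) auto
        then show "(- 2 * L + a\<^sub>1 * z\<^sub>1 t + a\<^sub>2 * z\<^sub>2 t + ((a\<^sub>1 * z\<^sub>1 t)\<^sup>2 + (a\<^sub>2 * z\<^sub>2 t)\<^sup>2) / \<kappa>) * y t \<le> r t * y t"
          by (intro mult_right_mono y0) (simp add: r_def)
        have "norm h \<le> norm (F\<^sub>1 t (w t)) + norm (F\<^sub>2 t (w t))"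
          using norm_triangle_ineq4[of "F\<^sub>2 t (w t)" "F\<^sub>1 t (w t)"]
            norm_ge_zero[of "F\<^sub>1 t (w t)"] norm_ge_zero[of "F\<^sub>2 t (w t)"]
          unfolding h_def norm_scaleR by linarith
        then have "norm h \<le> c t * (norm (w t) + 1)" using c(3)[of t "w t"] by linarith
        then have "(norm h)\<^sup>2 \<le> \<gamma> t" unfolding \<gamma>_def power2_eq_square by (intro mult_mono) (auto simp: c(2))
        then show "(norm h)\<^sup>2 / \<kappa> \<le> 1 / \<kappa> * \<gamma> t" using kpos by (simp add: divide_right_mono)
      qed
      finally show "D \<le> r t * y t + 1 / \<kappa> * \<gamma> t" .
    qed
    have "subexp_past y"
    proof (rule subexp_past_mono)
      let ?s = "\<lambda>t. norm (u t) + norm (v t) + norm (w t)"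
      show "subexp_past (\<lambda>t. 2 * (?s t * ?s t))"
        by (intro subexp_past_mult subexp_past_const subexp_past_add su sv w(2)) auto
      show "y t \<le> 2 * (?s t * ?s t)" for t
      proof -
        have "norm (u t - w t) \<le> ?s t" "norm (v t - w t) \<le> ?s t"
          using norm_triangle_ineq4[of "u t" "w t"] norm_triangle_ineq4[of "v t" "w t"]
            norm_ge_zero[of "u t"] norm_ge_zero[of "v t"] by linarith+
        then have "(norm (u t - w t))\<^sup>2 \<le> (?s t)\<^sup>2" "(norm (v t - w t))\<^sup>2 \<le> (?s t)\<^sup>2"
          by (auto intro!: power_mono)
        then show ?thesis unfolding y_def power2_eq_square[of "?s t"] by linarith
      qed
    qed
    then have "((\<lambda>t. exp (- P t) * y t) \<longlongrightarrow> 0) at_bot"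
      using weighted_subexp_past_vanishes[OF contP P(2) \<mu>] y0 by blast
    then have small: "\<exists>\<^sub>F t in at_bot. exp (- P t) * y t < \<epsilon>" if "\<epsilon> > 0" for \<epsilon>
      using that by (intro eventually_frequently order_tendstoD) auto
    have "y t \<le> 1 / \<kappa> * C * exp (1 * \<bar>t\<bar>)"
      using C(2)[rule_format, of "1 / \<kappa>" y, OF _ dy small t] kpos by simp
    then show ?thesis by (simp add: y_def)
  qed
  then show ?thesis using \<kappa>\<^sub>0 by blast
qed

end


section \<open>From random dynamics to pathwise solutions\<close>

lemma measurable_flow:
  assumes "metric_dynamical_system M \<theta>"
  shows "\<theta> t \<in> M \<rightarrow>\<^sub>M M"
proof -
  have "(\<lambda>(t, \<omega>). \<theta> t \<omega>) \<circ> Pair t \<in> M \<rightarrow>\<^sub>M M"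
    using assms unfolding metric_dynamical_system_def
    by (intro measurable_comp[where N = "borel \<Otimes>\<^sub>M M"] measurable_Pair1') auto
  then show ?thesis by (simp add: comp_def)
qed

text \<open>\<open>A k N\<close> is the event that \<open>X\<close> exceeds \<open>k\<close> at all integer times up to \<open>- N\<close>. By invariance of
  the measure it is no more likely than \<open>X > k\<close> at a single time, and this bound survives the
  increasing union over \<open>N\<close>. It tends to zero as \<open>k \<rightarrow> \<infinity>\<close>, so \<open>X\<close> almost surely does not
  diverge to \<open>\<infinity>\<close> in the past.\<close>

lemma recurrently_bounded:
  fixes X :: "'s \<Rightarrow> real"
  assumes M: "metric_dynamical_system M \<theta>" and X[measurable]: "X \<in> borel_measurable M"
  shows "AE \<omega> in M. \<exists>K. \<exists>\<^sub>F t in at_bot. X (\<theta> t \<omega>) \<le> K"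
proof -
  interpret prob_space M using M by (simp add: metric_dynamical_system_def)
  note [measurable] = measurable_flow[OF M]
  define B where "B k = {\<omega> \<in> space M. X \<omega> > real k}" for k
  have B[measurable]: "B k \<in> sets M" for k unfolding B_def by measurable
  define A where "A k N = {\<omega> \<in> space M. \<forall>n\<ge>N. X (\<theta> (- real n) \<omega>) > real k}" for k N :: nat
  have A[measurable]: "A k N \<in> sets M" for k N unfolding A_def by measurable
  have AB: "emeasure M (A k N) \<le> emeasure M (B k)" for k N
  proof -
    have "emeasure M (A k N) \<le> emeasure M (\<theta> (- real N) -` B k \<inter> space M)"
      using measurable_space[OF measurable_flow[OF M]]
      by (intro emeasure_mono) (auto simp: A_def B_def)
    also have "\<dots> = emeasure (distr M M (\<theta> (- real N))) (B k)"
      by (rule emeasure_distr[symmetric]) measurable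
    also have "distr M M (\<theta> (- real N)) = M" using M by (simp add: metric_dynamical_system_def)
    finally show ?thesis .
  qed
  have UB: "emeasure M (\<Union>N. A k N) \<le> emeasure M (B k)" for k
  proof -
    have "incseq (A k)" by (auto simp: incseq_def A_def)
    then have "(SUP N. emeasure M (A k N)) = emeasure M (\<Union>N. A k N)"
      by (intro SUP_emeasure_incseq) auto
    moreover have "(SUP N. emeasure M (A k N)) \<le> emeasure M (B k)" by (intro SUP_least AB)
    ultimately show ?thesis by simp
  qed
  define Z where "Z = (\<Inter>k. \<Union>N. A k N)"
  have Z: "Z \<in> sets M" unfolding Z_def by measurable
  have "(\<Inter>k. B k) = {}"
  proof (intro equals0I)
    fix \<omega> assume "\<omega> \<in> (\<Inter>k. B k)"
    moreover obtain k where "X \<omega> < real k" using reals_Archimedean2 by blast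
    ultimately show False by (auto simp: B_def dest!: spec[of _ k])
  qed
  moreover have "(\<lambda>k. emeasure M (B k)) \<longlonglongrightarrow> emeasure M (\<Inter>k. B k)"
    by (intro Lim_emeasure_decseq) (auto simp: decseq_def B_def)
  ultimately have "(\<lambda>k. emeasure M (B k)) \<longlonglongrightarrow> 0" by simp
  moreover have "emeasure M Z \<le> emeasure M (B k)" for k
    using UB[of k] by (intro order_trans[OF emeasure_mono UB]) (auto simp: Z_def)
  ultimately have "emeasure M Z \<le> 0"
    by (intro tendsto_lowerbound[where F = sequentially]) auto
  then have "Z \<in> null_sets M" using Z by auto
  then show ?thesis
  proof (rule AE_I')
    show "{\<omega> \<in> space M. \<not> (\<exists>K. \<exists>\<^sub>F t in at_bot. X (\<theta> t \<omega>) \<le> K)} \<subseteq> Z"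
    proof (intro subsetI, unfold Z_def, intro INT_I)
      fix \<omega> k assume \<omega>: "\<omega> \<in> {\<omega> \<in> space M. \<not> (\<exists>K. \<exists>\<^sub>F t in at_bot. X (\<theta> t \<omega>) \<le> K)}"
      then have "eventually (\<lambda>t. X (\<theta> t \<omega>) > real k) at_bot"
        by (auto simp: not_frequently not_le)
      then obtain N where N: "\<And>t. t \<le> N \<Longrightarrow> X (\<theta> t \<omega>) > real k" by (auto simp: eventually_at_bot_linorder)
      obtain n where "- N < real n" using reals_Archimedean2 by blast
      then have "\<omega> \<in> A k n" using \<omega> by (auto simp: A_def intro!: N)
      then show "\<omega> \<in> (\<Union>N. A k N)" by blast
    qed
  qed
qed

text \<open>The cocycle describes solutions only forward in time from its starting point. To reach the
  time \<open>t\<close> from the interior of such a half-line, start at \<open>t - 1\<close>: invariance says that the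
  forward solution from there runs along the orbit of \<open>X\<close>.\<close>

lemma invariant_point_solves:
  assumes M: "metric_dynamical_system M \<theta>" and gen: "generated_by M \<phi> F"
    and inv: "\<And>\<omega> t. \<omega> \<in> space M \<Longrightarrow> t > 0 \<Longrightarrow> \<phi> t \<omega> (X \<omega>) = X (\<theta> t \<omega>)"
    and F: "\<And>\<omega> s \<tau> x. \<omega> \<in> space M \<Longrightarrow> F s (\<theta> \<tau> \<omega>) x = F (s + \<tau>) \<omega> x"
    and \<omega>: "\<omega> \<in> space M"
  shows "((\<lambda>t. X (\<theta> t \<omega>)) has_vector_derivative F t \<omega> (X (\<theta> t \<omega>))) (at t)"
proof -
  define \<tau> where "\<tau> = t - 1"
  have \<omega>': "\<theta> \<tau> \<omega> \<in> space M" using measurable_space[OF measurable_flow[OF M] \<omega>] .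
  have eq: "\<phi> s (\<theta> \<tau> \<omega>) (X (\<theta> \<tau> \<omega>)) = X (\<theta> (s + \<tau>) \<omega>)" if "s > 0" for s
    using inv[OF \<omega>' that] M \<omega> by (simp add: metric_dynamical_system_def)
  have "((\<lambda>s. \<phi> s (\<theta> \<tau> \<omega>) (X (\<theta> \<tau> \<omega>))) has_vector_derivative
      F 1 (\<theta> \<tau> \<omega>) (\<phi> 1 (\<theta> \<tau> \<omega>) (X (\<theta> \<tau> \<omega>)))) (at 1 within {0..})"
    using gen \<omega>' unfolding generated_by_def by simp
  moreover have "at (1::real) within {0..} = at 1"
    by (rule at_within_open_subset[of _ "{0<..}"]) auto
  ultimately have "((\<lambda>s. \<phi> s (\<theta> \<tau> \<omega>) (X (\<theta> \<tau> \<omega>))) has_vector_derivative F t \<omega> (X (\<theta> t \<omega>))) (at 1)"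
    by (simp add: eq F[OF \<omega>]) (simp add: \<tau>_def)
  then have "((\<lambda>s. X (\<theta> (s + \<tau>) \<omega>)) has_vector_derivative F t \<omega> (X (\<theta> t \<omega>))) (at (t - \<tau>))"
    using has_vector_derivative_transform_within_open[of "\<lambda>s. \<phi> s (\<theta> \<tau> \<omega>) (X (\<theta> \<tau> \<omega>))" _ 1
        "{0<..}" "\<lambda>s. X (\<theta> (s + \<tau>) \<omega>)"] eq
    by (simp add: \<tau>_def)
  moreover have "((\<lambda>s. s - \<tau>) has_vector_derivative 1) (at t)"
    by (auto intro!: derivative_eq_intros)
  ultimately have "(((\<lambda>s. X (\<theta> (s + \<tau>) \<omega>)) \<circ> (\<lambda>s. s - \<tau>)) has_vector_derivative
      1 *\<^sub>R F t \<omega> (X (\<theta> t \<omega>))) (at t)"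
    by (intro vector_diff_chain_at)
  then show ?thesis by (simp add: comp_def)
qed

lemma tempered_singleton_subexp_past:
  assumes X: "tempered M \<theta> (\<lambda>\<omega>. {X \<omega>})" and \<omega>: "\<omega> \<in> space M"
    and cont: "continuous_on UNIV (\<lambda>t. X (\<theta> t \<omega>))"
  shows "subexp_past (\<lambda>t. norm (X (\<theta> t \<omega>)))"
proof (rule subexp_pastI)
  show "continuous_on UNIV (\<lambda>t. norm (X (\<theta> t \<omega>)))" by (intro continuous_intros cont)
  fix e :: real assume e: "e > 0"
  have "((\<lambda>t. ln (max 1 (norm (X (\<theta> t \<omega>)))) / \<bar>t\<bar>) \<longlongrightarrow> 0) at_infinity"
    using X \<omega> by (simp add: tempered_def)
  then have "((\<lambda>t. ln (max 1 (norm (X (\<theta> t \<omega>)))) / \<bar>t\<bar>) \<longlongrightarrow> 0) at_bot"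
    by (rule tendsto_mono[OF at_bot_le_at_infinity])
  then have "eventually (\<lambda>t. ln (max 1 (norm (X (\<theta> t \<omega>)))) / \<bar>t\<bar> < e) at_bot"
    using e by (rule order_tendstoD)
  then show "eventually (\<lambda>t. norm (X (\<theta> t \<omega>)) \<le> exp (e * \<bar>t\<bar>)) at_bot"
    using eventually_gt_at_bot[of 0]
  proof eventually_elim
    case (elim t)
    then have "ln (max 1 (norm (X (\<theta> t \<omega>)))) \<le> e * \<bar>t\<bar>"
      by (subst (asm) pos_divide_less_eq) auto
    then have "max 1 (norm (X (\<theta> t \<omega>))) \<le> exp (e * \<bar>t\<bar>)" 
      by (metis exp_le_cancel_iff exp_ln less_max_iff_disj zero_less_one)
    then show ?case by simp
  qed
qed

lemma OU_path_shift:
  assumes "continuous_on UNIV \<omega>"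
  shows "((\<lambda>t. fst (\<omega> t) / t) \<longlongrightarrow> 0) at_infinity \<Longrightarrow> OU1 (path_shift \<tau> \<omega>) s = OU1 \<omega> (s + \<tau>)"
    and "((\<lambda>t. snd (\<omega> t) / t) \<longlongrightarrow> 0) at_infinity \<Longrightarrow> OU2 (path_shift \<tau> \<omega>) s = OU2 \<omega> (s + \<tau>)"
  using fOU_shift[of "\<lambda>t. fst (\<omega> t)" \<tau> s] fOU_shift[of "\<lambda>t. snd (\<omega> t)" \<tau> s] assms
  by (simp_all add: path_shift_def continuous_on_fst continuous_on_snd)

lemma ou_like_fOU:
  assumes "regular_path H v x" "continuous_on UNIV x"
  shows "ou_like (fOU x) v"
  using assms continuous_on_fOU[of x] unfolding regular_path_def ou_like_def by blast

lemma (in dissipative_pair) uniform_synchronization: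
  fixes \<kappa> :: "nat \<Rightarrow> real"
  assumes w: "averaged_solution F\<^sub>1 F\<^sub>2 w" "subexp_past (\<lambda>t. norm (w t))"
    and uv: "\<And>\<kappa>. \<kappa> \<ge> 1 \<Longrightarrow> coupled_solution F\<^sub>1 F\<^sub>2 \<kappa> (u \<kappa>) (v \<kappa>)"
      "\<And>\<kappa>. \<kappa> \<ge> 1 \<Longrightarrow> subexp_past (\<lambda>t. norm (u \<kappa> t))" "\<And>\<kappa>. \<kappa> \<ge> 1 \<Longrightarrow> subexp_past (\<lambda>t. norm (v \<kappa> t))"
    and \<kappa>: "filterlim \<kappa> at_top sequentially"
  shows "uniform_limit {T\<^sub>1..T\<^sub>2} (\<lambda>n t. (u (\<kappa> n) t, v (\<kappa> n) t)) (\<lambda>t. (w t, w t)) sequentially"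
proof (rule uniform_limitI)
  fix e :: real assume e: "e > 0"
  obtain C \<kappa>\<^sub>0 where \<kappa>\<^sub>0: "\<kappa>\<^sub>0 \<ge> 1" and C: "\<And>k u v t. k \<ge> \<kappa>\<^sub>0 \<Longrightarrow> coupled_solution F\<^sub>1 F\<^sub>2 k u v \<Longrightarrow>
      subexp_past (\<lambda>t. norm (u t)) \<Longrightarrow> subexp_past (\<lambda>t. norm (v t)) \<Longrightarrow> t \<le> T\<^sub>2 \<Longrightarrow>
      (norm (u t - w t))\<^sup>2 + (norm (v t - w t))\<^sup>2 \<le> C / k * exp \<bar>t\<bar>"
    using synchronization_rate[OF w, of T\<^sub>2] by blast
  define R where "R = \<bar>C\<bar> * exp (\<bar>T\<^sub>1\<bar> + \<bar>T\<^sub>2\<bar>)"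
  have "eventually (\<lambda>n. \<kappa> n > max \<kappa>\<^sub>0 (R / e\<^sup>2)) sequentially"
    using \<kappa> unfolding filterlim_at_top_dense by blast
  then show "\<forall>\<^sub>F n in sequentially. \<forall>t\<in>{T\<^sub>1..T\<^sub>2}. dist (u (\<kappa> n) t, v (\<kappa> n) t) (w t, w t) < e"
  proof eventually_elim
    case (elim n)
    define k where "k = \<kappa> n"
    have k: "k \<ge> \<kappa>\<^sub>0" "k > 0" "R / e\<^sup>2 < k" "k \<ge> 1" using elim \<kappa>\<^sub>0 by (auto simp: k_def)
    show ?case
    proof
      fix t assume t: "t \<in> {T\<^sub>1..T\<^sub>2}"
      have "(norm (u k t - w t))\<^sup>2 + (norm (v k t - w t))\<^sup>2 \<le> C / k * exp \<bar>t\<bar>"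
        using t k by (intro C uv) auto
      also have "\<dots> \<le> \<bar>C\<bar> / k * exp (\<bar>T\<^sub>1\<bar> + \<bar>T\<^sub>2\<bar>)"
        using t k by (intro mult_mono divide_right_mono) auto
      also have "\<dots> = R / k" by (simp add: R_def)
      also have "\<dots> < e\<^sup>2" using k e by (simp add: field_simps)
      finally have "sqrt ((norm (u k t - w t))\<^sup>2 + (norm (v k t - w t))\<^sup>2) < e"
        using e by (simp add: real_less_lsqrt)
      then show "dist (u (\<kappa> n) t, v (\<kappa> n) t) (w t, w t) < e"
        unfolding dist_Pair_Pair by (simp add: dist_norm k_def)
    qed
  qed
qed

theorem theorem6p1:
  fixes f g :: "real ^ 'd \<Rightarrow> real ^ 'd"
    and a\<^sub>1 a\<^sub>2 H\<^sub>1 H\<^sub>2 :: real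
    and b\<^sub>1 b\<^sub>2 :: "real ^ 'd"
    and P :: "path measure" and \<Omega> :: "path set"
    and \<phi> :: "real \<Rightarrow> real \<Rightarrow> path \<Rightarrow> (real ^ 'd) \<times> (real ^ 'd) \<Rightarrow> (real ^ 'd) \<times> (real ^ 'd)"
    and U V :: "real \<Rightarrow> path \<Rightarrow> real ^ 'd"
    and W :: "path \<Rightarrow> real ^ 'd"
  defines "M \<equiv> restrict_space P \<Omega>"
  assumes "linear_growth f" "linear_growth g"
    and "dissipative_lipschitz f" "dissipative_lipschitz g"
    and "integrability_condition f g"
    and "a\<^sub>1 \<noteq> 0" "a\<^sub>2 \<noteq> 0"
    and "H\<^sub>1 \<in> {1/2<..<1}" "H\<^sub>2 \<in> {1/2<..<1}"
    and "fbm_path_law H\<^sub>1 H\<^sub>2 P"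
    and "restricted_sample_space H\<^sub>1 H\<^sub>2 P \<Omega>"
    and "\<And>\<kappa>. \<kappa> \<ge> 1 \<Longrightarrow> random_dynamical_system M path_shift (\<phi> \<kappa>)"
    and "\<And>\<kappa>. \<kappa> \<ge> 1 \<Longrightarrow> generated_by M (\<phi> \<kappa>) (coupled_field f g a\<^sub>1 a\<^sub>2 b\<^sub>1 b\<^sub>2 \<kappa>)"
    and "\<And>\<kappa>. \<kappa> \<ge> 1 \<Longrightarrow> random_attractor M path_shift (\<phi> \<kappa>) (\<lambda>\<omega>. {(U \<kappa> \<omega>, V \<kappa> \<omega>)})"
    and "stationary_solution M path_shift (averaged_field f g a\<^sub>1 a\<^sub>2 b\<^sub>1 b\<^sub>2) W"
  shows "(AE \<omega> in M. synchronizes path_shift U V W \<omega>) \<and>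
    (tempered M path_shift (\<lambda>\<omega>. {W \<omega>}) \<longrightarrow> (\<forall>\<omega>\<in>\<Omega>. synchronizes path_shift U V W \<omega>))"
proof -
  obtain L\<^sub>1 where L\<^sub>1: "L\<^sub>1 > 0" "\<And>x y. (x - y) \<bullet> (f x - f y) \<le> - L\<^sub>1 * (norm (x - y))\<^sup>2"
    using \<open>dissipative_lipschitz f\<close> unfolding dissipative_lipschitz_def by blast
  obtain L\<^sub>2 where L\<^sub>2: "L\<^sub>2 > 0" "\<And>x y. (x - y) \<bullet> (g x - g y) \<le> - L\<^sub>2 * (norm (x - y))\<^sup>2"
    using \<open>dissipative_lipschitz g\<close> unfolding dissipative_lipschitz_def by blast
  define L where "L = min L\<^sub>1 L\<^sub>2"
  have L: "L > 0" using L\<^sub>1(1) L\<^sub>2(1) by (simp add: L_def)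
  have dissip: "(x - y) \<bullet> (f x - f y) \<le> - L * (norm (x - y))\<^sup>2"
    "(x - y) \<bullet> (g x - g y) \<le> - L * (norm (x - y))\<^sup>2" for x y
    by (rule order_trans[OF L\<^sub>1(2)], simp add: L_def mult_right_mono)
      (rule order_trans[OF L\<^sub>2(2)], simp add: L_def mult_right_mono)
  note rds = assms(13) and generated = assms(14) and attractor = assms(15) and stationary = assms(16)
  note \<Omega> = \<open>restricted_sample_space H\<^sub>1 H\<^sub>2 P \<Omega>\<close>[unfolded restricted_sample_space_def]
  have "space P = space path_space"
    using \<open>fbm_path_law H\<^sub>1 H\<^sub>2 P\<close> by (intro sets_eq_imp_space_eq) (simp add: fbm_path_law_def)
  moreover have \<Omega>P: "\<Omega> \<subseteq> space P" using \<Omega> sets.sets_into_space by blast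
  ultimately have cont: "continuous_on UNIV \<omega>" if "\<omega> \<in> \<Omega>" for \<omega>
    using that by (auto simp: path_space_def space_restrict_space)
  have M: "space M = \<Omega>" using \<Omega>P by (auto simp: M_def space_restrict_space)
  define \<nu>\<^sub>1 \<nu>\<^sub>2 where "\<nu>\<^sub>1 = (\<integral>\<omega>. (OU1 \<omega> 0)\<^sup>2 \<partial>P)" and "\<nu>\<^sub>2 = (\<integral>\<omega>. (OU2 \<omega> 0)\<^sup>2 \<partial>P)"
  have reg: "regular_path H\<^sub>1 \<nu>\<^sub>1 (\<lambda>s. fst (\<omega> s))" "regular_path H\<^sub>2 \<nu>\<^sub>2 (\<lambda>s. snd (\<omega> s))" if "\<omega> \<in> \<Omega>" for \<omega>
    using \<Omega> that by (auto simp: \<nu>\<^sub>1_def \<nu>\<^sub>2_def)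
  have mds: "metric_dynamical_system M path_shift"
    using rds[of 1] by (simp add: random_dynamical_system_def)
  have OU: "ou_like (OU1 \<omega>) \<nu>\<^sub>1" "ou_like (OU2 \<omega>) \<nu>\<^sub>2" if "\<omega> \<in> \<Omega>" for \<omega>
    using ou_like_fOU reg[OF that] cont[OF that] by (auto simp: continuous_on_fst continuous_on_snd)
  have pair: "dissipative_pair (\<lambda>t. noisy_drift f a\<^sub>1 b\<^sub>1 (OU1 \<omega> t)) (\<lambda>t. noisy_drift g a\<^sub>2 b\<^sub>2 (OU2 \<omega> t))
      (OU1 \<omega>) (OU2 \<omega>) a\<^sub>1 a\<^sub>2 \<nu>\<^sub>1 \<nu>\<^sub>2 L" if "\<omega> \<in> \<Omega>" for \<omega>
  proof
    show "L > 0" by (rule L)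
    show "ou_like (OU1 \<omega>) \<nu>\<^sub>1" "ou_like (OU2 \<omega>) \<nu>\<^sub>2" using OU[OF that] by auto
    then show "\<exists>c. subexp_past c \<and> (\<forall>t. 0 \<le> c t) \<and>
        (\<forall>t w. norm (noisy_drift f a\<^sub>1 b\<^sub>1 (OU1 \<omega> t) w) \<le> c t * (norm w + 1))"
      "\<exists>c. subexp_past c \<and> (\<forall>t. 0 \<le> c t) \<and>
        (\<forall>t w. norm (noisy_drift g a\<^sub>2 b\<^sub>2 (OU2 \<omega> t) w) \<le> c t * (norm w + 1))"
      using \<open>linear_growth f\<close> \<open>linear_growth g\<close> \<open>a\<^sub>1 \<noteq> 0\<close> \<open>a\<^sub>2 \<noteq> 0\<close>
      by (auto simp: ou_like_def intro!: noisy_drift_growth)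
  qed (rule noisy_drift_dissipative[OF dissip(1)] noisy_drift_dissipative[OF dissip(2)])+
  have coupled: "((\<lambda>t. (U \<kappa> (path_shift t \<omega>), V \<kappa> (path_shift t \<omega>))) has_vector_derivative
      coupled_field f g a\<^sub>1 a\<^sub>2 b\<^sub>1 b\<^sub>2 \<kappa> t \<omega> (U \<kappa> (path_shift t \<omega>), V \<kappa> (path_shift t \<omega>))) (at t)"
    if "\<kappa> \<ge> 1" "\<omega> \<in> \<Omega>" for \<kappa> \<omega> t
  proof (rule invariant_point_solves[OF mds generated[OF that(1)], where X = "\<lambda>\<omega>. (U \<kappa> \<omega>, V \<kappa> \<omega>)"])
    show "\<omega> \<in> space M" using that M by simp
    show "\<phi> \<kappa> t \<omega> (U \<kappa> \<omega>, V \<kappa> \<omega>) = (U \<kappa> (path_shift t \<omega>), V \<kappa> (path_shift t \<omega>))"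
      if "\<omega> \<in> space M" "t > 0" for \<omega> t
      using attractor[OF \<open>\<kappa> \<ge> 1\<close>] that by (simp add: random_attractor_def)
    show "coupled_field f g a\<^sub>1 a\<^sub>2 b\<^sub>1 b\<^sub>2 \<kappa> s (path_shift \<tau> \<omega>) x =
        coupled_field f g a\<^sub>1 a\<^sub>2 b\<^sub>1 b\<^sub>2 \<kappa> (s + \<tau>) \<omega> x" if "\<omega> \<in> space M" for \<omega> s \<tau> x
      using that reg[of \<omega>] OU_path_shift[OF cont, of \<omega> \<tau> s]
      by (simp add: M coupled_field_def regular_path_def)
  qed
  have averaged: "averaged_solution (\<lambda>t. noisy_drift f a\<^sub>1 b\<^sub>1 (OU1 \<omega> t))
      (\<lambda>t. noisy_drift g a\<^sub>2 b\<^sub>2 (OU2 \<omega> t)) (\<lambda>t. W (path_shift t \<omega>))" if "\<omega> \<in> \<Omega>" for \<omega>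
  proof -
    have "averaged_field f g a\<^sub>1 a\<^sub>2 b\<^sub>1 b\<^sub>2 t \<omega> w =
        (1 / 2) *\<^sub>R (noisy_drift f a\<^sub>1 b\<^sub>1 (OU1 \<omega> t) w + noisy_drift g a\<^sub>2 b\<^sub>2 (OU2 \<omega> t) w)" for t w
      by (simp add: averaged_field_def noisy_drift_def scaleR_add_right[of "1 / 2"] ac_simps)
    moreover have "((\<lambda>t. W (path_shift t \<omega>)) has_vector_derivative
        averaged_field f g a\<^sub>1 a\<^sub>2 b\<^sub>1 b\<^sub>2 t \<omega> (W (path_shift t \<omega>))) (at t)" for t
      using stationary that unfolding stationary_solution_def M by blast
    ultimately show ?thesis by (simp add: averaged_solution_def)
  qed
  have sync: "synchronizes path_shift U V W \<omega>"
    if \<omega>: "\<omega> \<in> \<Omega>" and sub: "subexp_past (\<lambda>t. norm (W (path_shift t \<omega>)))" for \<omega>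
  proof -
    interpret dissipative_pair "\<lambda>t. noisy_drift f a\<^sub>1 b\<^sub>1 (OU1 \<omega> t)" "\<lambda>t. noisy_drift g a\<^sub>2 b\<^sub>2 (OU2 \<omega> t)"
      "OU1 \<omega>" "OU2 \<omega>" a\<^sub>1 a\<^sub>2 \<nu>\<^sub>1 \<nu>\<^sub>2 L by (rule pair[OF \<omega>])
    let ?u = "\<lambda>\<kappa> t. U \<kappa> (path_shift t \<omega>)" and ?v = "\<lambda>\<kappa> t. V \<kappa> (path_shift t \<omega>)"
    have uv: "coupled_solution (\<lambda>t. noisy_drift f a\<^sub>1 b\<^sub>1 (OU1 \<omega> t)) (\<lambda>t. noisy_drift g a\<^sub>2 b\<^sub>2 (OU2 \<omega> t))
        \<kappa> (?u \<kappa>) (?v \<kappa>)" if "\<kappa> \<ge> 1" for \<kappa>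
      using bounded_linear.has_vector_derivative[OF bounded_linear_fst coupled[OF that \<omega>]]
        bounded_linear.has_vector_derivative[OF bounded_linear_snd coupled[OF that \<omega>]]
      by (auto simp: coupled_solution_def coupled_field_def noisy_drift_def)
    have pair_subexp: "subexp_past (\<lambda>t. norm (?u \<kappa> t, ?v \<kappa> t))" if "\<kappa> \<ge> 1" for \<kappa>
    proof (rule tempered_singleton_subexp_past[where X = "\<lambda>\<omega>. (U \<kappa> \<omega>, V \<kappa> \<omega>)" and \<theta> = path_shift])
      show "tempered M path_shift (\<lambda>\<omega>. {(U \<kappa> \<omega>, V \<kappa> \<omega>)})"
        using attractor[OF that] by (simp add: random_attractor_def)
      show "continuous_on UNIV (\<lambda>t. (?u \<kappa> t, ?v \<kappa> t))"
        using coupled[OF that \<omega>] by (meson has_vector_derivative_continuous continuous_at_imp_continuous_on)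
    qed (use \<omega> M in simp)
    have "subexp_past (\<lambda>t. norm (?u \<kappa> t))" "subexp_past (\<lambda>t. norm (?v \<kappa> t))" if "\<kappa> \<ge> 1" for \<kappa>
      by (rule subexp_past_mono[OF pair_subexp[OF that]], simp add: norm_fst_le norm_snd_le)+
    with uv show ?thesis
      unfolding synchronizes_def using uniform_synchronization[OF averaged[OF \<omega>] sub, of ?u ?v] by blast
  qed
  show ?thesis
  proof
    have "AE \<omega> in M. \<exists>K. \<exists>\<^sub>F t in at_bot. norm (W (path_shift t \<omega>)) \<le> K"
      using stationary by (intro recurrently_bounded[OF mds]) (auto simp: stationary_solution_def)
    then show "AE \<omega> in M. synchronizes path_shift U V W \<omega>"
      using AE_space
    proof eventually_elim
      case (elim \<omega>)
      then have \<omega>: "\<omega> \<in> \<Omega>" by (simp add: M)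
      interpret dissipative_pair "\<lambda>t. noisy_drift f a\<^sub>1 b\<^sub>1 (OU1 \<omega> t)" "\<lambda>t. noisy_drift g a\<^sub>2 b\<^sub>2 (OU2 \<omega> t)"
        "OU1 \<omega>" "OU2 \<omega>" a\<^sub>1 a\<^sub>2 \<nu>\<^sub>1 \<nu>\<^sub>2 L by (rule pair[OF \<omega>])
      show ?case using elim averaged_solution_subexp_past[OF averaged[OF \<omega>]] by (intro sync \<omega>) blast
    qed
    show "tempered M path_shift (\<lambda>\<omega>. {W \<omega>}) \<longrightarrow> (\<forall>\<omega>\<in>\<Omega>. synchronizes path_shift U V W \<omega>)"
    proof (intro impI ballI)
      fix \<omega> assume temp: "tempered M path_shift (\<lambda>\<omega>. {W \<omega>})" and \<omega>: "\<omega> \<in> \<Omega>"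
      have "continuous_on UNIV (\<lambda>t. W (path_shift t \<omega>))"
        using stationary \<omega> unfolding stationary_solution_def M
        by (meson has_vector_derivative_continuous continuous_at_imp_continuous_on)
      then show "synchronizes path_shift U V W \<omega>"
        using \<omega> M by (intro sync tempered_singleton_subexp_past[OF temp]) auto
    qed
  qed
qed

end
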